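(* For every $\varepsilon,\delta>0$, every $m\in\mathbb{N}$, and every $d\geq 4$ with $d\geq m\,\delta^{-2}\varepsilon^{-1}$, the following is true. Let $\mathbb{X}^d=\mathbb{R}^d$ or $\mathbb{C}^d$ and let $B$ be a random orthonormal basis of $\mathbb{X}^d$ with distribution $u_{ONB(\mathbb{X}^d)}$. For every partition $A_1,\ldots,A_m$ of $\mathbb{S}(\mathbb{X}^d)$ consisting of Borel sets, $$\mathbb{P}\biggl(\forall k\in\{1,\ldots,m\}:\Bigl|\frac{\#(B\cap A_k)}{d}-u(A_k)\Bigr|\leq\delta\biggr)\geq 1-\varepsilon.$$
   Context: $\mathbb{S}(\mathbb{X}^d)$ is the unit sphere of $\mathbb{X}^d$ (with its standard inner product); $u$ is the uniform probability measure (normalized surface area) on $\mathbb{S}(\mathbb{X}^d)$; $\#S$ is the number of elements of a finite set $S$. $\mathbb{N}$ is the set of positive integers. $G$ is the orthogonal group $O(d)$ if $\mathbb{X}^d=\mathbb{R}^d$ and the unitary group $U(d)$ if $\mathbb{X}^d=\mathbb{C}^d$. The uniform distribution $u_{ONB(\mathbb{X}^d)}$ over orthonormal bases of $\mathbb{X}^d$ is the distribution of $R(B_0)$, where $B_0$ is any fixed orthonormal basis and $R$ is a random element of $G$ distributed according to normalized Haar measure; it does not depend on the choice of $B_0$. *)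

theory Defs
  imports "HOL-Probability.Probability"
begin

text \<open>
  Surface area on the unit sphere, in the polar-coordinates normalization: the area of \<open>A\<close> is the
  dimension times the volume of the cone \<open>{r x | 0 < r \<le> 1, x \<in> A}\<close> over \<open>A\<close>
  (see \<open>emeasure_sphere_surface\<close>). On \<open>complex ^ 'n\<close> this is the area of the real
  sphere of dimension \<open>2 * CARD('n) - 1\<close>.
\<close>

definition sphere_surface :: "'a::euclidean_space measure" where
  "sphere_surface =
     scale_measure (of_nat DIM('a))
       (distr (restrict_space lborel (cball 0 1 - {0})) (restrict_space borel (sphere 0 1))
          (\<lambda>x. x /\<^sub>R norm x))"

definition sphere_uniform :: "'a::euclidean_space measure" where
  "sphere_uniform = uniform_measure sphere_surface (sphere 0 1)"

definition orthogonal_group :: "(real ^ 'n ^ 'n) set" where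
  "orthogonal_group = {R. orthogonal_matrix R}"

definition cadjoint :: "complex ^ 'n ^ 'm \<Rightarrow> complex ^ 'm ^ 'n" where
  "cadjoint U = (\<chi> i j. cnj (U $ j $ i))"

definition unitary_group :: "(complex ^ 'n ^ 'n) set" where
  "unitary_group = {U. cadjoint U ** U = mat 1 \<and> U ** cadjoint U = mat 1}"

text \<open>
  Normalized Haar measure of a compact matrix group. Regularity is automatic for finite Borel
  measures on a compact metrizable space.
\<close>

definition normalized_haar ::
    "('a::{semiring_1,topological_space} ^ 'n ^ 'n) set \<Rightarrow> ('a ^ 'n ^ 'n) measure \<Rightarrow> bool" where
  "normalized_haar G \<mu> \<longleftrightarrow>
     prob_space \<mu> \<and> sets \<mu> = sets (restrict_space borel G) \<and>
     (\<forall>g\<in>G. \<forall>S\<in>sets \<mu>. emeasure \<mu> ((\<lambda>h. g ** h) ` S) = emeasure \<mu> S)"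

definition real_onbs :: "(real ^ 'n) set set" where
  "real_onbs = {B. (\<forall>b\<in>B. \<forall>c\<in>B. b \<bullet> c = (if b = c then 1 else 0)) \<and> span B = UNIV}"

definition cinner :: "complex ^ 'n \<Rightarrow> complex ^ 'n \<Rightarrow> complex" where
  "cinner x y = (\<Sum>i\<in>UNIV. cnj (x $ i) * y $ i)"

text \<open>Here \<open>vec.span\<close> is the linear span over the scalar field \<open>complex\<close>.\<close>

definition complex_onbs :: "(complex ^ 'n) set set" where
  "complex_onbs =
     {B. (\<forall>b\<in>B. \<forall>c\<in>B. cinner b c = (if b = c then 1 else 0)) \<and> vec.span B = UNIV}"

text \<open>
  Orthonormal bases are (unordered) finite subsets of the sphere. A family of them carries the usual
  \<open>\<sigma>\<close>-algebra of random finite sets, generated by the counting maps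
  \<open>B \<mapsto> card (B \<inter> A)\<close> for Borel sets \<open>A\<close> of the sphere.
\<close>

definition onb_space :: "('a::real_normed_vector ^ 'n) set set \<Rightarrow> ('a ^ 'n) set measure" where
  "onb_space \<B> =
     sigma \<B> {{B \<in> \<B>. card (B \<inter> A) = k} | A k. A \<in> sets borel \<and> A \<subseteq> sphere 0 1}"

text \<open>
  \<open>\<nu>\<close> is the law of \<open>R(B0)\<close> for a Haar-distributed \<open>R\<close>; it depends neither on
  the basis \<open>B0\<close> nor, by uniqueness of Haar measure, on \<open>\<mu>\<close>.
\<close>

definition uniform_onb ::
    "('a::real_normed_field ^ 'n ^ 'n) set \<Rightarrow> ('a ^ 'n) set set \<Rightarrow> ('a ^ 'n) set measure \<Rightarrow> bool" where
  "uniform_onb G \<B> \<nu> \<longleftrightarrow>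
     (\<exists>\<mu> B0. normalized_haar G \<mu> \<and> B0 \<in> \<B> \<and>
        \<nu> = distr \<mu> (onb_space \<B>) (\<lambda>R. (\<lambda>b. R *v b) ` B0))"

definition borel_partition :: "nat \<Rightarrow> (nat \<Rightarrow> 'a::topological_space set) \<Rightarrow> 'a set \<Rightarrow> bool" where
  "borel_partition m A S \<longleftrightarrow>
     (\<forall>k\<in>{1..m}. A k \<in> sets borel) \<and> disjoint_family_on A {1..m} \<and> (\<Union>k\<in>{1..m}. A k) = S"

lemma normalize_measurable:
  "(\<lambda>x::'a::euclidean_space. x /\<^sub>R norm x)
     \<in> restrict_space lborel (cball 0 1 - {0}) \<rightarrow>\<^sub>M restrict_space borel (sphere 0 1)"
proof (rule measurable_restrict_space2)
  show "(\<lambda>x::'a. x /\<^sub>R norm x) \<in> restrict_space lborel (cball 0 1 - {0}) \<rightarrow>\<^sub>M borel"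
    by (rule measurable_restrict_space1) measurable
qed (auto simp: space_restrict_space)

lemma emeasure_sphere_surface:
  fixes A :: "'a::euclidean_space set"
  assumes "A \<in> sets borel" and "A \<subseteq> sphere 0 1"
  shows "emeasure sphere_surface A =
           of_nat DIM('a) * emeasure lborel {r *\<^sub>R x | r x. 0 < r \<and> r \<le> 1 \<and> x \<in> A}"
proof -
  let ?C = "cball 0 1 - {0::'a}"
  have A: "A \<in> sets (restrict_space borel (sphere 0 1))"
    using assms by (auto simp: sets_restrict_space_iff)
  have eq: "(\<lambda>x::'a. x /\<^sub>R norm x) -` A \<inter> ?C = {r *\<^sub>R x | r x. 0 < r \<and> r \<le> 1 \<and> x \<in> A}"
  proof (intro set_eqI iffI)
    fix y assume y: "y \<in> (\<lambda>x::'a. x /\<^sub>R norm x) -` A \<inter> ?C"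
    then have "y = norm y *\<^sub>R (y /\<^sub>R norm y)" by simp
    with y show "y \<in> {r *\<^sub>R x | r x. 0 < r \<and> r \<le> 1 \<and> x \<in> A}"
      by (intro CollectI exI[of _ "norm y"] exI[of _ "y /\<^sub>R norm y"]) auto
  next
    fix y assume "y \<in> {r *\<^sub>R x | r x. 0 < r \<and> r \<le> 1 \<and> x \<in> A}"
    then obtain r x where "y = r *\<^sub>R x" "0 < r" "r \<le> 1" "x \<in> A" by auto
    moreover from this assms(2) have "norm x = 1" by auto
    ultimately show "y \<in> (\<lambda>x::'a. x /\<^sub>R norm x) -` A \<inter> ?C" by auto
  qed
  show ?thesis
    unfolding sphere_surface_def emeasure_scale_measure
    by (subst emeasure_distr[OF normalize_measurable A])
      (simp add: space_restrict_space eq, subst emeasure_restrict_space, auto simp: eq[symmetric])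
qed

lemma prob_space_sphere_uniform: "prob_space (sphere_uniform :: 'a::euclidean_space measure)"
proof -
  have sub: "{r *\<^sub>R x | r x. 0 < r \<and> r \<le> 1 \<and> x \<in> sphere (0::'a) 1} = cball 0 1 - {0}"
  proof (intro set_eqI iffI)
    fix y :: 'a assume y: "y \<in> cball 0 1 - {0}"
    then show "y \<in> {r *\<^sub>R x | r x. 0 < r \<and> r \<le> 1 \<and> x \<in> sphere (0::'a) 1}"
      by (intro CollectI exI[of _ "norm y"] exI[of _ "y /\<^sub>R norm y"]) auto
  qed auto
  have e: "emeasure lborel (cball 0 1 - {0::'a}) = emeasure lborel (cball (0::'a) 1)"
    by (rule emeasure_Diff_null_set) auto
  have pos: "emeasure lborel (cball (0::'a) 1) \<noteq> 0"
    using content_cball_pos[of 1 "0::'a"] by (auto simp: measure_def)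
  have fin: "emeasure lborel (cball (0::'a) 1) \<noteq> \<infinity>"
    using emeasure_lborel_cball_finite[of "0::'a" 1] by auto
  have *: "emeasure sphere_surface (sphere (0::'a) 1) = of_nat DIM('a) * emeasure lborel (cball (0::'a) 1)"
    by (subst emeasure_sphere_surface) (auto simp only: sub e borel_closed closed_sphere)
  show ?thesis unfolding sphere_uniform_def
    by (rule prob_space_uniform_measure)
       (use pos fin in \<open>auto simp: * ennreal_mult_eq_top_iff\<close>)
qed

end

theory Submission
  imports Defs
begin

text \<open>
  Let \<open>R\<close> be Haar distributed and \<open>e, e'\<close> orthonormal. By right invariance the pairs \<open>(R b, R c)\<close> with
  \<open>b \<noteq> c\<close> in the basis all have the law of \<open>(R e, R e')\<close>, so the variance of the number of basis vectors in
  \<open>A\<close> is controlled once the bilinear form \<open>Q f g = E [f (R e) g (R e')]\<close> is bounded on mean-zero functions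
  by \<open>1 / (d - 1)\<close> times the \<open>L\<^sup>2\<close> form \<open>B f g = E [f (R e) g (R e)]\<close>; Chebyshev's inequality and a union
  bound then finish the proof.

  The bound on \<open>Q\<close> is a triangularity argument. Averaging a function \<open>\<phi> \<langle>a, y\<rangle>\<close>, with \<open>\<phi>\<close> homogeneous of
  degree \<open>2p\<close>, over the unit vectors \<open>y\<close> orthogonal to \<open>x\<close> gives a constant times
  \<open>(|a|\<^sup>2 - |\<langle>a, x\<rangle>|\<^sup>2)\<^sup>p\<close>. Hence \<open>|\<langle>a, x\<rangle>|^(2p)\<close> is mapped to a multiple of itself plus lower powers, the
  multiple being at most \<open>1 / (d - 1)\<close> in absolute value, and the real powers \<open>(a \<bullet> x)\<^sup>i\<close> are mapped into the
  span of these functions. Adjoining such functions one at a time to the constants and using orthogonal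
  projections yields the bound on the span of all powers \<open>(a \<bullet> x)\<^sup>i\<close>, which is dense by Stone--Weierstrass
  applied to the algebra spanned by the functions \<open>exp (a \<bullet> x)\<close>.

  The real and the complex case are treated together: the scalar field enters only through its conjugation.
\<close>

section \<open>Bounding one form by another along a flag of subspaces\<close>

definition adjoin :: "('v \<Rightarrow> real) set \<Rightarrow> ('v \<Rightarrow> real) \<Rightarrow> ('v \<Rightarrow> real) set" where
  "adjoin W g = {(\<lambda>x. w x + \<alpha> * g x) | w \<alpha>. w \<in> W}"

lemma adjoinI: "w \<in> W \<Longrightarrow> (\<lambda>x. w x + \<alpha> * g x) \<in> adjoin W g"
  unfolding adjoin_def by blast

lemma adjoinE:
  assumes "f \<in> adjoin W g" obtains w \<alpha> where "f = (\<lambda>x. w x + \<alpha> * g x)" "w \<in> W"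
  using assms unfolding adjoin_def by blast

lemma adjoin_mono: "w \<in> W \<Longrightarrow> w \<in> adjoin W g"
  using adjoinI[of w W 0 g] by simp

text \<open>Think of an operator \<open>T\<close> with \<open>Q f g = B f (T g)\<close>. It is never
  constructed: every use of it is phrased through \<open>Q\<close> and \<open>B\<close>.
  \<open>B\<close> is only positive semidefinite because it will see a function through its values
  on the sphere alone; \<open>Q_one\<close> says that \<open>T\<close> fixes the constants.\<close>

locale form_pair =
  fixes F :: "('v \<Rightarrow> real) set"
    and B Q :: "('v \<Rightarrow> real) \<Rightarrow> ('v \<Rightarrow> real) \<Rightarrow> real"
    and lam :: real
  assumes F_const: "(\<lambda>_. c) \<in> F"
    and F_lin: "f \<in> F \<Longrightarrow> g \<in> F \<Longrightarrow> (\<lambda>x. f x + c * g x) \<in> F"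
    and B_lin: "f \<in> F \<Longrightarrow> g \<in> F \<Longrightarrow> h \<in> F \<Longrightarrow> B (\<lambda>x. f x + c * g x) h = B f h + c * B g h"
    and Q_lin: "f \<in> F \<Longrightarrow> g \<in> F \<Longrightarrow> h \<in> F \<Longrightarrow> Q (\<lambda>x. f x + c * g x) h = Q f h + c * Q g h"
    and B_sym: "f \<in> F \<Longrightarrow> g \<in> F \<Longrightarrow> B f g = B g f"
    and Q_sym: "f \<in> F \<Longrightarrow> g \<in> F \<Longrightarrow> Q f g = Q g f"
    and B_pos: "f \<in> F \<Longrightarrow> B f f \<ge> 0"
    and B_one: "B (\<lambda>_. 1) (\<lambda>_. 1) = 1"
    and Q_one: "f \<in> F \<Longrightarrow> Q f (\<lambda>_. 1) = B f (\<lambda>_. 1)"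
begin

text \<open>In terms of \<open>T\<close> the last premise reads \<open>T g = c g + k\<close> with
  \<open>k\<close> already present: \<open>T\<close> is triangular along the flag, with diagonal
  entries at most \<open>lam\<close> after the initial 1 on the constants. Adjoined functions may be
  linearly dependent or \<open>B\<close>-null.\<close>

inductive flag :: "('v \<Rightarrow> real) set \<Rightarrow> bool" where
  flag_const: "flag (range (\<lambda>c _. c))"
| flag_extend: "flag W \<Longrightarrow> g \<in> F \<Longrightarrow> c \<le> lam \<Longrightarrow> k \<in> W \<Longrightarrow>
    (\<And>f. f \<in> F \<Longrightarrow> Q f g = c * B f g + B f k) \<Longrightarrow>
    flag (adjoin W g)"

lemma flag_subset: "flag W \<Longrightarrow> W \<subseteq> F"
  by (induction rule: flag.induct) (auto intro!: F_const F_lin elim!: adjoinE)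

lemma flag_contains_const: "flag W \<Longrightarrow> (\<lambda>_. c) \<in> W"
proof (induction rule: flag.induct)
  case (flag_extend W g c' k)
  then show ?case by (intro adjoin_mono)
qed auto

lemma flag_lin: "flag W \<Longrightarrow> f \<in> W \<Longrightarrow> g \<in> W \<Longrightarrow> (\<lambda>x. f x + c * g x) \<in> W"
proof (induction arbitrary: f g c rule: flag.induct)
  case (flag_extend W h c' k)
  then obtain w \<alpha> w' \<alpha>' where *: "f = (\<lambda>x. w x + \<alpha> * h x)" "g = (\<lambda>x. w' x + \<alpha>' * h x)" "w \<in> W" "w' \<in> W"
    by (auto elim!: adjoinE)
  have "(\<lambda>x. f x + c * g x) = (\<lambda>x. (w x + c * w' x) + (\<alpha> + c * \<alpha>') * h x)"
    by (auto simp: * algebra_simps)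
  moreover have "(\<lambda>x. w x + c * w' x) \<in> W" using flag_extend.IH * by blast
  ultimately show ?case using adjoinI[of "\<lambda>x. w x + c * w' x" W "\<alpha> + c * \<alpha>'" h] by simp
qed auto

lemma flag_scale: "flag W \<Longrightarrow> f \<in> W \<Longrightarrow> (\<lambda>x. c * f x) \<in> W"
  using flag_lin[of W "\<lambda>_. 0" f c] flag_contains_const[of W 0] by simp

lemma flag_add: "flag W \<Longrightarrow> f \<in> W \<Longrightarrow> g \<in> W \<Longrightarrow> (\<lambda>x. f x + g x) \<in> W"
  using flag_lin[of W f g 1] by simp

lemma flag_sum:
  assumes W: "flag W" and "finite I" "\<And>i. i \<in> I \<Longrightarrow> h i \<in> W"
  shows "(\<lambda>x. \<Sum>i\<in>I. c i * h i x) \<in> W"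
  using assms(2,3)
proof (induction I rule: finite_induct)
  case empty
  then show ?case using flag_contains_const[OF W] by simp
next
  case (insert i I)
  then have "(\<lambda>x. c i * h i x + (\<Sum>i\<in>I. c i * h i x)) \<in> W"
    by (intro flag_add[OF W] flag_scale[OF W]) auto
  then show ?case using insert by simp
qed

lemma flag_adjoin_new:
  assumes "flag W" shows "g \<in> adjoin W g"
  using adjoinI[OF flag_contains_const[OF assms, of 0], of 1 g] by simp

lemma F_diff: "f \<in> F \<Longrightarrow> g \<in> F \<Longrightarrow> (\<lambda>x. f x - g x) \<in> F"
  using F_lin[of f g "-1"] by simp

lemma B_lin_right:
  "f \<in> F \<Longrightarrow> g \<in> F \<Longrightarrow> h \<in> F \<Longrightarrow> B h (\<lambda>x. f x + c * g x) = B h f + c * B h g"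
  using B_lin[of f g h c] B_sym[OF _ F_lin, of h f g c] B_sym[of h f] B_sym[of h g] by simp

lemma Q_lin_right:
  "f \<in> F \<Longrightarrow> g \<in> F \<Longrightarrow> h \<in> F \<Longrightarrow> Q h (\<lambda>x. f x + c * g x) = Q h f + c * Q h g"
  using Q_lin[of f g h c] Q_sym[OF _ F_lin, of h f g c] Q_sym[of h f] Q_sym[of h g] by simp

lemma zero_right:
  assumes "f \<in> F" shows "B f (\<lambda>_. 0) = 0" "Q f (\<lambda>_. 0) = 0"
  using B_lin_right[of "\<lambda>_. 0" "\<lambda>_. 0" f 1] Q_lin_right[of "\<lambda>_. 0" "\<lambda>_. 0" f 1] F_const assms by simp_all

lemma B_scale_right: "f \<in> F \<Longrightarrow> g \<in> F \<Longrightarrow> B f (\<lambda>x. c * g x) = c * B f g"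
  using B_lin_right[of "\<lambda>_. 0" g f c] zero_right[of f] F_const by simp

lemma Q_scale_right: "f \<in> F \<Longrightarrow> g \<in> F \<Longrightarrow> Q f (\<lambda>x. c * g x) = c * Q f g"
  using Q_lin_right[of "\<lambda>_. 0" g f c] zero_right[of f] F_const by simp

lemma B_square:
  assumes "f \<in> F" "g \<in> F"
  shows "B (\<lambda>x. f x + c * g x) (\<lambda>x. f x + c * g x) = B f f + 2 * c * B f g + c * c * B g g"
  by (simp only: B_lin[OF assms F_lin[OF assms]] B_lin_right[OF assms assms(1)]
      B_lin_right[OF assms assms(2)] B_sym[OF assms(2,1)]) (simp add: algebra_simps)

lemma Q_square:
  assumes "f \<in> F" "g \<in> F"
  shows "Q (\<lambda>x. f x + c * g x) (\<lambda>x. f x + c * g x) = Q f f + 2 * c * Q f g + c * c * Q g g"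
  by (simp only: Q_lin[OF assms F_lin[OF assms]] Q_lin_right[OF assms assms(1)]
      Q_lin_right[OF assms assms(2)] Q_sym[OF assms(2,1)]) (simp add: algebra_simps)

text \<open>Otherwise \<open>B\<close> of \<open>f + c g\<close> with itself would be affine and
  nonconstant in \<open>c\<close>, hence negative somewhere. This takes care of degenerate
  directions in the projection below.\<close>

lemma B_null_orthogonal:
  assumes "f \<in> F" "g \<in> F" "B g g = 0" shows "B f g = 0"
proof (rule ccontr)
  assume ne: "B f g \<noteq> 0"
  \<comment> \<open>The value of \<open>c\<close> at which the affine function equals -1.\<close>
  define c where "c = - (B f f + 1) / (2 * B f g)"
  let ?h = "\<lambda>x. f x + c * g x"
  have h: "?h \<in> F" using assms F_lin by blast
  have "B ?h ?h = B f f + 2 * c * B f g + c * c * B g g"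
    by (rule B_square) fact+
  also have "\<dots> = -1" using ne assms by (simp add: c_def field_simps)
  finally show False using B_pos[OF h] by simp
qed

text \<open>Gram-Schmidt along the flag: the remainders \<open>r\<close> and \<open>s\<close> of
  \<open>p\<close> and of the new function \<open>g\<close> are already orthogonal to
  \<open>W\<close>, so it remains to remove from \<open>r\<close> its component along
  \<open>s\<close>. On the constants the projection is the mean.\<close>

lemma flag_projection:
  "flag W \<Longrightarrow> p \<in> F \<Longrightarrow> \<exists>q\<in>W. \<forall>w\<in>W. B (\<lambda>x. p x - q x) w = 0"
proof (induction arbitrary: p rule: flag.induct)
  case flag_const
  have "B (\<lambda>x. p x + (- B p (\<lambda>_. 1)) * 1) (\<lambda>_. c) = 0" for c
  proof -
    let ?r = "\<lambda>x. p x + (- B p (\<lambda>_. 1)) * 1"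
    have r: "?r \<in> F" by (rule F_lin[OF flag_const F_const[of 1]])
    have "B ?r (\<lambda>_. 1) = 0" using flag_const F_const B_one by (subst B_lin) auto
    then show ?thesis using B_scale_right[OF r F_const[of 1], of c] by simp
  qed
  then show ?case by (auto intro!: bexI[of _ "\<lambda>_. B p (\<lambda>_. 1)"])
next
  case (flag_extend W g c k)
  have WF: "W \<subseteq> F" using flag_subset flag_extend by blast
  obtain q where q: "q \<in> W" "\<forall>w\<in>W. B (\<lambda>x. p x - q x) w = 0" using flag_extend by blast
  obtain h where h: "h \<in> W" "\<forall>w\<in>W. B (\<lambda>x. g x - h x) w = 0" using flag_extend by blast
  define r s where "r = (\<lambda>x. p x - q x)" and "s = (\<lambda>x. g x - h x)"
  have rs: "r \<in> F" "s \<in> F" unfolding r_def s_def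
    using q h WF flag_extend.prems flag_extend.hyps F_diff by auto
  \<comment> \<open>If \<open>B s s = 0\<close>, division gives \<open>t = 0\<close>, which is still
    the right coefficient because then \<open>B r s = 0\<close>.\<close>
  define t where "t = B r s / B s s"
  have t: "B r s = t * B s s"
    using B_null_orthogonal[OF rs] by (cases "B s s = 0") (auto simp: t_def)
  let ?q = "\<lambda>x. (q x + (- t) * h x) + t * g x"
  have "?q \<in> adjoin W g"
    by (rule adjoinI[OF flag_lin[OF flag_extend.hyps(1) q(1) h(1), of "-t"]])
  moreover have "B (\<lambda>x. p x - ?q x) v = 0" if "v \<in> adjoin W g" for v
  proof -
    from that obtain w \<alpha> where v: "v = (\<lambda>x. w x + \<alpha> * g x)" "w \<in> W" by (rule adjoinE)
    define w' where "w' = (\<lambda>x. w x + \<alpha> * h x)"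
    have w': "w' \<in> W" unfolding w'_def using flag_lin flag_extend.hyps v h by blast
    then have w'F: "w' \<in> F" using WF by blast
    have v': "v = (\<lambda>x. w' x + \<alpha> * s x)" by (auto simp: v w'_def s_def algebra_simps)
    have e: "(\<lambda>x. p x - ?q x) = (\<lambda>x. r x + (- t) * s x)" by (auto simp: r_def s_def algebra_simps)
    have "B r w' = 0" "B s w' = 0" using q h w' by (auto simp: r_def s_def)
    then show ?thesis unfolding e v'
      by (simp only: B_lin[OF rs F_lin[OF w'F rs(2)]] B_lin_right[OF w'F rs(2) rs(1)]
          B_lin_right[OF w'F rs(2) rs(2)] t) (simp add: algebra_simps)
  qed
  ultimately show ?case by (intro bexI[of _ ?q] ballI)
qed

text \<open>Triangularity makes every space of a flag invariant under \<open>T\<close>; the witness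
  plays the role of \<open>T p\<close>.\<close>

lemma flag_invariant:
  "flag W \<Longrightarrow> p \<in> W \<Longrightarrow> \<exists>k\<in>W. \<forall>f\<in>F. Q f p = B f k"
proof (induction arbitrary: p rule: flag.induct)
  case flag_const
  then obtain c where p: "p = (\<lambda>_. c)" by auto
  have "Q f p = B f p" if f: "f \<in> F" for f
    using B_scale_right[OF f F_const[of 1], of c] Q_scale_right[OF f F_const[of 1], of c] Q_one[OF f]
    by (simp add: p)
  then show ?case using p by (auto intro!: bexI[of _ p])
next
  case (flag_extend W g c k)
  have WF: "W \<subseteq> F" using flag_subset flag_extend by blast
  obtain w \<alpha> where p: "p = (\<lambda>x. w x + \<alpha> * g x)" "w \<in> W" using flag_extend.prems by (auto elim: adjoinE)
  obtain k' where k': "k' \<in> W" "\<forall>f\<in>F. Q f w = B f k'" using flag_extend p by blast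
  let ?k = "\<lambda>x. (k' x + \<alpha> * k x) + (\<alpha> * c) * g x"
  have kW: "(\<lambda>x. k' x + \<alpha> * k x) \<in> W" using flag_lin flag_extend.hyps k' by blast
  have "Q f p = B f ?k" if f: "f \<in> F" for f
  proof -
    have "Q f p = Q f w + \<alpha> * Q f g" unfolding p(1)
      using f p WF flag_extend.hyps by (intro Q_lin_right) auto
    also have "\<dots> = B f k' + \<alpha> * (c * B f g + B f k)"
      using f k' flag_extend.hyps(5) by simp
    also have "\<dots> = (B f k' + \<alpha> * B f k) + (\<alpha> * c) * B f g" by (simp add: algebra_simps)
    also have "\<dots> = B f ?k"
      using f k' flag_extend.hyps WF kW
      by (subst B_lin_right, blast, blast, blast) (subst B_lin_right, auto)
    finally show ?thesis .
  qed
  then show ?case using adjoinI[OF kW] by blast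
qed

text \<open>Split \<open>p = q + r\<close> with \<open>q\<close> the projection to the smaller space
  \<open>W\<close>. Invariance makes \<open>r\<close> orthogonal to \<open>W\<close> for
  \<open>Q\<close> as well, so both forms are additive over the splitting. The induction hypothesis
  covers \<open>q\<close>, which keeps mean zero because \<open>W\<close> contains the constants; on
  \<open>r\<close> the form \<open>Q\<close> is exactly \<open>c\<close> times
  \<open>B\<close>.\<close>

lemma flag_bound:
  "flag W \<Longrightarrow> p \<in> W \<Longrightarrow> B p (\<lambda>_. 1) = 0 \<Longrightarrow> Q p p \<le> lam * B p p"
proof (induction arbitrary: p rule: flag.induct)
  case flag_const
  then obtain c where p: "p = (\<lambda>_. c)" by auto
  have pF: "p \<in> F" using p F_const by simp
  show ?case
    using B_scale_right[OF pF F_const[of 1], of c] Q_scale_right[OF pF F_const[of 1], of c]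
      Q_one[OF pF] flag_const p by simp
next
  case (flag_extend W g c k)
  have WF: "W \<subseteq> F" using flag_subset flag_extend by blast
  obtain w \<alpha> where p: "p = (\<lambda>x. w x + \<alpha> * g x)" "w \<in> W" using flag_extend.prems by (auto elim: adjoinE)
  have pF: "p \<in> F" unfolding p using p WF flag_extend.hyps by (intro F_lin) auto
  obtain q where q: "q \<in> W" "\<And>w. w \<in> W \<Longrightarrow> B (\<lambda>x. p x - q x) w = 0"
    using flag_projection[OF flag_extend.hyps(1) pF] by blast
  define r where "r = (\<lambda>x. p x - q x)"
  have F: "q \<in> F" "r \<in> F" "g \<in> F" using q WF pF F_diff flag_extend.hyps by (auto simp: r_def)
  have rW: "B r w = 0" if "w \<in> W" for w using q(2) that by (simp add: r_def)
  have QrW: "Q r w = 0" if "w \<in> W" for w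
    using flag_invariant[OF flag_extend.hyps(1) that] rW F by auto
  have p': "p = (\<lambda>x. q x + 1 * r x)" by (auto simp: r_def)
  define v where "v = (\<lambda>x. w x + (-1) * q x)"
  have v: "v \<in> W" unfolding v_def using flag_lin flag_extend.hyps p q by blast
  have r': "r = (\<lambda>x. v x + \<alpha> * g x)" by (auto simp: r_def v_def p)
  \<comment> \<open>Modulo \<open>W\<close> the remainder \<open>r\<close> is a multiple of
    \<open>g\<close>, so only the diagonal entry \<open>c\<close> survives.\<close>
  have "Q r r = Q r v + \<alpha> * Q r g"
    by (subst (2) r', rule Q_lin_right) (use v WF F in auto)
  also have "\<dots> = c * (\<alpha> * B r g)"
    using QrW[OF v] flag_extend.hyps(4,5) rW F by simp
  also have "\<alpha> * B r g = B r (\<lambda>x. v x + \<alpha> * g x)"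
    using rW[OF v] v WF F by (subst B_lin_right) auto
  also have "\<dots> = B r r" using r' by simp
  finally have Qrr: "Q r r = c * B r r" .
  have "Q p p = Q q q + Q r r"
    using Q_square[OF F(1,2), of 1, folded p'] QrW[OF q(1)] Q_sym[OF F(1,2)] by simp
  moreover have "B p p = B q q + B r r"
    using B_square[OF F(1,2), of 1, folded p'] rW[OF q(1)] B_sym[OF F(1,2)] by simp
  moreover have "B q (\<lambda>_. 1) = 0"
  proof -
    have "B p (\<lambda>_. 1) = B q (\<lambda>_. 1) + 1 * B r (\<lambda>_. 1)"
      unfolding p' using F F_const by (intro B_lin) auto
    then show ?thesis using flag_extend.prems rW[OF flag_contains_const[OF flag_extend.hyps(1)]] by simp
  qed
  then have "Q q q \<le> lam * B q q" using flag_extend.IH q by blast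
  moreover have "c * B r r \<le> lam * B r r" using flag_extend.hyps B_pos F by (intro mult_right_mono) auto
  ultimately show ?case using Qrr by (simp add: algebra_simps)
qed

text \<open>Centering \<open>p\<close> lowers both forms by the square of its mean, since
  \<open>Q\<close> and \<open>B\<close> agree against constants.\<close>

lemma flag_variance_bound:
  assumes W: "flag W" "p \<in> W"
  shows "Q p p - (B p (\<lambda>_. 1))\<^sup>2 \<le> lam * (B p p - (B p (\<lambda>_. 1))\<^sup>2)"
proof -
  define b where "b = B p (\<lambda>_. 1)"
  define p0 where "p0 = (\<lambda>x. p x + (- b) * 1)"
  have F: "p \<in> F" "(\<lambda>_. 1) \<in> F" using assms flag_subset F_const by blast+
  have p0W: "p0 \<in> W" unfolding p0_def using flag_lin[OF W flag_contains_const[OF W(1)]] .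
  have p0F: "p0 \<in> F" using p0W flag_subset W by blast
  have 1: "B p0 (\<lambda>_. 1) = 0" unfolding p0_def using F B_one by (subst B_lin) (auto simp: b_def)
  have "B p0 p0 = B p0 p + (- b) * B p0 (\<lambda>_. 1)"
    by (subst (2) p0_def, rule B_lin_right) (use F p0F in auto)
  also have "B p0 p = B p p + (- b) * B (\<lambda>_. 1) p"
    unfolding p0_def by (rule B_lin) (use F in auto)
  also have "B (\<lambda>_. 1) p = b" using B_sym[OF F] b_def by simp
  finally have 2: "B p0 p0 = B p p - b\<^sup>2" using 1 by (simp add: power2_eq_square)
  have "Q p0 p0 = Q p0 p + (- b) * Q p0 (\<lambda>_. 1)"
    by (subst (2) p0_def, rule Q_lin_right) (use F p0F in auto)
  also have "Q p0 p = Q p p + (- b) * Q (\<lambda>_. 1) p"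
    unfolding p0_def by (rule Q_lin) (use F in auto)
  also have "Q (\<lambda>_. 1) p = b" using Q_sym[OF F] Q_one[OF F(1)] b_def by simp
  also have "Q p0 (\<lambda>_. 1) = 0" using 1 Q_one p0F by simp
  finally have 3: "Q p0 p0 = Q p p - b\<^sup>2" by (simp add: power2_eq_square)
  show ?thesis using flag_bound[OF W(1) p0W 1] 2 3 by (simp add: b_def)
qed

end

section \<open>Isometry invariance of the uniform measure on the sphere\<close>

text \<open>Any translation-invariant \<open>\<sigma>\<close>-finite measure is proportional to Lebesgue measure, by Fubini; a linear
  isometry fixes the unit ball, so the factor is 1.\<close>

lemma distr_lborel_isometry:
  fixes g :: "'a::euclidean_space \<Rightarrow> 'a"
  assumes g: "orthogonal_transformation g"
  shows "distr lborel borel g = lborel"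
proof -
  define \<nu> where "\<nu> = distr lborel borel g"
  have lin: "linear g" using g orthogonal_transformation_def by blast
  have gm[measurable]: "g \<in> borel_measurable borel"
    by (intro borel_measurable_continuous_onI linear_continuous_on linear_conv_bounded_linear[THEN iffD1] lin)
  obtain g' where g': "linear g'" "\<And>x. g' (g x) = x" "\<And>x. g (g' x) = x"
    using orthogonal_transformation_bij[OF g] orthogonal_transformation_inv[OF g] orthogonal_transformation_def
    by (metis bij_inv_eq_iff)
  have sets\<nu>[measurable_cong, simp]: "sets \<nu> = sets borel" by (simp add: \<nu>_def)
  have ball: "g -` ball 0 r = ball 0 r" for r
    using g by (auto simp: orthogonal_transformation_norm)
  have \<nu>ball: "emeasure \<nu> (ball 0 r) = emeasure lborel (ball (0::'a) r)" for r
    by (simp add: \<nu>_def emeasure_distr ball)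
  have "sigma_finite_measure \<nu>"
  proof
    show "\<exists>A. countable A \<and> A \<subseteq> sets \<nu> \<and> \<Union> A = space \<nu> \<and> (\<forall>a\<in>A. emeasure \<nu> a \<noteq> \<infinity>)"
    proof (intro exI[of _ "range (\<lambda>n. ball 0 (real n))"] conjI ballI)
      show "\<Union> (range (\<lambda>n. ball 0 (real n))) = space \<nu>"
        by (auto simp: \<nu>_def intro: reals_Archimedean2)
    next
      fix a :: "'a set" assume "a \<in> range (\<lambda>n. ball 0 (real n))"
      then show "emeasure \<nu> a \<noteq> \<infinity>" using \<nu>ball emeasure_lborel_ball_finite[of "0::'a"] by (auto simp: less_top)
    qed auto
  qed
  then interpret \<nu>: sigma_finite_measure \<nu> .
  interpret pair_sigma_finite \<nu> "lborel :: 'a measure" ..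
  have trans: "(\<integral>\<^sup>+x. h (x + y) \<partial>\<nu>) = (\<integral>\<^sup>+x. h x \<partial>\<nu>)" if [measurable]: "h \<in> borel_measurable borel" for h y
  proof -
    have "(\<integral>\<^sup>+x. h (x + y) \<partial>\<nu>) = (\<integral>\<^sup>+x. h (g (x + g' y)) \<partial>lborel)"
      using lin g' by (simp add: \<nu>_def nn_integral_distr linear_add)
    also have "\<dots> = (\<integral>\<^sup>+x. h (g x) \<partial>distr lborel borel ((+) (g' y)))"
      by (subst nn_integral_distr) (auto simp: add.commute)
    also have "\<dots> = (\<integral>\<^sup>+x. h x \<partial>\<nu>)"
      by (simp add: lborel_distr_plus \<nu>_def nn_integral_distr)
    finally show ?thesis .
  qed
  \<comment> \<open>The double integral of the indicator of \<open>x\<close> in \<open>A\<close> and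
    \<open>x + y\<close> in \<open>B\<close> is evaluated twice: directly, and after the shift of
    \<open>x\<close> by \<open>- y\<close> that \<open>trans\<close> allows. Each time the inner
    integral over \<open>y\<close> is a Lebesgue measure, by translation and reflection
    invariance.\<close>
  have key: "emeasure \<nu> A * emeasure lborel B = emeasure lborel A * emeasure \<nu> B"
    if [measurable]: "A \<in> sets borel" "B \<in> sets borel" for A B
  proof -
    have "emeasure \<nu> A * emeasure lborel B = (\<integral>\<^sup>+x. indicator A x * emeasure lborel B \<partial>\<nu>)"
      by (simp add: nn_integral_multc)
    also have "emeasure lborel B = (\<integral>\<^sup>+y. indicator B (x + y) \<partial>lborel)" for x
    proof -
      have "emeasure lborel B = (\<integral>\<^sup>+y. indicator B y \<partial>distr lborel borel ((+) x))"
        by (simp add: lborel_distr_plus)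
      also have "\<dots> = (\<integral>\<^sup>+y. indicator B (x + y) \<partial>lborel)" by (rule nn_integral_distr) auto
      finally show ?thesis .
    qed
    then have "(\<integral>\<^sup>+x. indicator A x * emeasure lborel B \<partial>\<nu>) =
        (\<integral>\<^sup>+x. \<integral>\<^sup>+y. indicator A x * indicator B (x + y) \<partial>lborel \<partial>\<nu>)"
      by (simp add: nn_integral_cmult)
    also have "\<dots> = (\<integral>\<^sup>+y. \<integral>\<^sup>+x. indicator A x * indicator B (x + y) \<partial>\<nu> \<partial>lborel)"
      by (rule Fubini'[symmetric]) measurable
    also have "\<dots> = (\<integral>\<^sup>+y. \<integral>\<^sup>+x. indicator A (x - y) * indicator B x \<partial>\<nu> \<partial>lborel)"
    proof (rule nn_integral_cong)
      fix y
      show "(\<integral>\<^sup>+x. indicator A x * indicator B (x + y) \<partial>\<nu>) = (\<integral>\<^sup>+x. indicator A (x - y) * indicator B x \<partial>\<nu>)"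
        using trans[of "\<lambda>x. indicator A (x - y) * indicator B x" y] by simp
    qed
    also have "\<dots> = (\<integral>\<^sup>+x. \<integral>\<^sup>+y. indicator A (x - y) * indicator B x \<partial>lborel \<partial>\<nu>)"
      by (rule Fubini') measurable
    also have "\<dots> = (\<integral>\<^sup>+x. emeasure lborel A * indicator B x \<partial>\<nu>)"
    proof (rule nn_integral_cong)
      fix x
      have "emeasure lborel A = (\<integral>\<^sup>+y. indicator A y \<partial>distr lborel borel (\<lambda>y. x + (-1) *\<^sub>R y))"
        using lborel_affine[of "-1" x] by (simp add: density_1)
      also have "\<dots> = (\<integral>\<^sup>+y. indicator A (x - y) \<partial>lborel)"
        by (subst nn_integral_distr) auto
      finally show "(\<integral>\<^sup>+y. indicator A (x - y) * indicator B x \<partial>lborel) = emeasure lborel A * indicator B x"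
        by (simp add: nn_integral_multc)
    qed
    also have "\<dots> = emeasure lborel A * emeasure \<nu> B"
      by (simp add: nn_integral_cmult)
    finally show ?thesis .
  qed
  show ?thesis unfolding \<nu>_def[symmetric]
  proof (rule measure_eqI)
    fix A assume "A \<in> sets \<nu>"
    then have A: "A \<in> sets borel" by simp
    have b: "emeasure lborel (ball (0::'a) 1) \<noteq> \<infinity>" "emeasure lborel (ball (0::'a) 1) \<noteq> 0"
      using emeasure_lborel_ball_finite[of "0::'a" 1] content_ball_pos[of 1 "0::'a"] by (auto simp: less_top measure_def)
    from key[OF A, of "ball 0 1"] show "emeasure \<nu> A = emeasure lborel A"
      unfolding \<nu>ball using b by (simp add: mult.commute[of "emeasure _ A"] ennreal_mult_cancel_left)
  qed simp
qed

lemma sets_sphere_surface[simp]: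
  "sets (sphere_surface :: 'a::euclidean_space measure) = sets (restrict_space borel (sphere 0 1))"
  by (simp add: sphere_surface_def)

lemma sets_sphere_uniform[simp]:
  "sets (sphere_uniform :: 'a::euclidean_space measure) = sets (restrict_space borel (sphere 0 1))"
  by (simp add: sphere_uniform_def)

lemma space_sphere_uniform[simp]: "space (sphere_uniform :: 'a::euclidean_space measure) = sphere 0 1"
  using sets_eq_imp_space_eq[OF sets_sphere_uniform] by (simp add: space_restrict_space)

lemma cone_eq_preimage:
  fixes A :: "'a::euclidean_space set"
  assumes "A \<subseteq> sphere 0 1"
  shows "{r *\<^sub>R x | r x. 0 < r \<and> r \<le> 1 \<and> x \<in> A} = (\<lambda>x. x /\<^sub>R norm x) -` A \<inter> (cball 0 1 - {0})"
proof (intro set_eqI iffI)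
  fix y assume y: "y \<in> (\<lambda>x. x /\<^sub>R norm x) -` A \<inter> (cball 0 1 - {0})"
  then have "y = norm y *\<^sub>R (y /\<^sub>R norm y)" by simp
  with y show "y \<in> {r *\<^sub>R x | r x. 0 < r \<and> r \<le> 1 \<and> x \<in> A}"
    by (intro CollectI exI[of _ "norm y"] exI[of _ "y /\<^sub>R norm y"]) auto
next
  fix y assume "y \<in> {r *\<^sub>R x | r x. 0 < r \<and> r \<le> 1 \<and> x \<in> A}"
  then obtain r x where "y = r *\<^sub>R x" "0 < r" "r \<le> 1" "x \<in> A" by auto
  moreover from this assms have "norm x = 1" by auto
  ultimately show "y \<in> (\<lambda>x. x /\<^sub>R norm x) -` A \<inter> (cball 0 1 - {0})" by auto
qed

text \<open>The cone over a preimage is the preimage of the cone, so the invariance of Lebesgue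
  measure carries over to surface area.\<close>

lemma emeasure_sphere_surface_isometry:
  fixes g :: "'a::euclidean_space \<Rightarrow> 'a"
  assumes g: "orthogonal_transformation g" and A: "A \<in> sets borel" "A \<subseteq> sphere 0 1"
  shows "emeasure sphere_surface (g -` A) = emeasure sphere_surface A"
proof -
  have lin: "linear g" using g orthogonal_transformation_def by blast
  have gm[measurable]: "g \<in> borel_measurable borel"
    by (intro borel_measurable_continuous_onI linear_continuous_on linear_conv_bounded_linear[THEN iffD1] lin)
  have gA: "g -` A \<in> sets borel" "g -` A \<subseteq> sphere 0 1"
    using measurable_sets_borel[OF gm A(1)] A(2) orthogonal_transformation_norm[OF g] by auto
  let ?cone = "\<lambda>A. {r *\<^sub>R x | r x. 0 < r \<and> r \<le> 1 \<and> x \<in> A}"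
  have eq: "?cone (g -` A) = g -` ?cone A"
  proof (intro set_eqI iffI)
    fix y assume "y \<in> ?cone (g -` A)"
    then show "y \<in> g -` ?cone A" using lin by (auto simp: linear_scale) blast
  next
    fix y assume "y \<in> g -` ?cone A"
    then obtain r x where *: "g y = r *\<^sub>R x" "0 < r" "r \<le> 1" "x \<in> A" by auto
    then have "g (y /\<^sub>R r) = x" using lin by (simp add: linear_scale)
    then have "y = r *\<^sub>R (y /\<^sub>R r)" "y /\<^sub>R r \<in> g -` A" using * by auto
    then show "y \<in> ?cone (g -` A)" using * by blast
  qed
  have "?cone A = (\<lambda>x. x /\<^sub>R norm x) -` A \<inter> (cball 0 1 - {0})" by (rule cone_eq_preimage[OF A(2)])
  moreover have "(\<lambda>x::'a. x /\<^sub>R norm x) -` A \<in> sets borel"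
    by (rule measurable_sets_borel[OF _ A(1)]) measurable
  ultimately have cone: "?cone A \<in> sets borel" by auto
  have "emeasure lborel (g -` ?cone A) = emeasure (distr lborel borel g) (?cone A)"
    using cone by (subst emeasure_distr) auto
  then show ?thesis
    by (simp only: emeasure_sphere_surface[OF gA] emeasure_sphere_surface[OF A] eq distr_lborel_isometry[OF g])
qed

lemma emeasure_sphere_uniform_isometry:
  fixes g :: "'a::euclidean_space \<Rightarrow> 'a"
  assumes g: "orthogonal_transformation g" and A: "A \<in> sets borel" "A \<subseteq> sphere 0 1"
  shows "emeasure sphere_uniform (g -` A) = emeasure sphere_uniform A"
proof -
  have lin: "linear g" using g orthogonal_transformation_def by blast
  have gm: "g \<in> borel_measurable borel"
    by (intro borel_measurable_continuous_onI linear_continuous_on linear_conv_bounded_linear[THEN iffD1] lin)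
  have gA: "g -` A \<in> sets borel" "g -` A \<subseteq> sphere 0 1"
    using measurable_sets_borel[OF gm A(1)] A(2) orthogonal_transformation_norm[OF g] by auto
  have "C \<in> sets sphere_surface \<and> sphere 0 1 \<inter> C = C" if "C \<in> sets borel" "C \<subseteq> sphere 0 1" for C :: "'a set"
    using that by (auto simp: sets_restrict_space_iff)
  then show ?thesis using gA A
    by (simp add: sphere_uniform_def emeasure_uniform_measure emeasure_sphere_surface_isometry[OF g A] sets_restrict_space_iff)
qed

section \<open>Unitary matrices over a field with conjugation\<close>

text \<open>\<open>cj_inner\<close> ties conjugation to the Euclidean structure: the inner product
  of two scalars is the real part of \<open>cj z * w\<close>, expressed without mentioning real
  parts. At \<open>z = 1\<close> it gives an explicit formula for \<open>cj\<close>, from which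
  continuity and real linearity follow.\<close>

locale conj_field =
  fixes cj :: "'a::{real_normed_field,euclidean_space} \<Rightarrow> 'a"
  assumes cj_add: "cj (x + y) = cj x + cj y"
    and cj_mult: "cj (x * y) = cj x * cj y"
    and cj_cj [simp]: "cj (cj x) = x"
    and cj_inner: "cj z * w + cj w * z = of_real (2 * (z \<bullet> w))"
begin

lemma cj_zero [simp]: "cj 0 = 0"
  using cj_add[of 0 0] by simp

lemma cj_minus [simp]: "cj (- x) = - cj x"
  using cj_add[of x "- x"] by (simp add: eq_neg_iff_add_eq_0 add.commute)

lemma cj_diff: "cj (x - y) = cj x - cj y"
  using cj_add[of x "- y"] by simp

lemma cj_sum: "cj (sum f A) = (\<Sum>i\<in>A. cj (f i))"
  by (induction A rule: infinite_finite_induct) (auto simp: cj_add)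

lemma cj_one [simp]: "cj 1 = 1"
proof -
  have "cj 1 \<noteq> 0" using cj_cj[of 1] by (metis cj_zero zero_neq_one)
  moreover have "cj 1 * cj 1 = cj 1 * 1" using cj_mult[of 1 1] by simp
  ultimately show ?thesis using mult_left_cancel by blast
qed

lemma cj_divide: "cj (x / y) = cj x / cj y"
proof (cases "y = 0")
  case False
  then have "cj (x / y) * cj y = cj x" by (simp add: cj_mult[symmetric])
  moreover have "cj y \<noteq> 0" using False by (metis cj_cj cj_zero)
  ultimately show ?thesis by (simp add: field_simps)
qed simp

lemma cj_norm: "cj z * z = of_real ((norm z)\<^sup>2)"
proof -
  have "2 * (cj z * z) = 2 * of_real ((norm z)\<^sup>2)"
    using cj_inner[of z z] by (simp add: power2_norm_eq_inner mult.commute)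
  then show ?thesis by simp
qed

lemma norm_cj [simp]: "norm (cj z) = norm z"
proof -
  have "norm (cj z) * norm z = norm z * norm z"
    using arg_cong[OF cj_norm[of z], of norm] by (simp add: norm_mult power2_eq_square)
  then show ?thesis by (cases "z = 0") auto
qed

lemma cj_eq: "cj w = of_real (2 * (1 \<bullet> w)) - w"
  using cj_inner[of 1 w] by (simp add: algebra_simps)

lemma continuous_on_cj [continuous_intros]:
  assumes "continuous_on S f" shows "continuous_on S (\<lambda>x. cj (f x))"
  unfolding cj_eq using assms by (intro continuous_intros)

definition ip :: "'a ^ 'n \<Rightarrow> 'a ^ 'n \<Rightarrow> 'a" where
  "ip x y = (\<Sum>i\<in>UNIV. cj (x $ i) * y $ i)"

lemma ip_diff_left: "ip (x - y) z = ip x z - ip y z"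
  by (simp add: ip_def cj_diff algebra_simps sum_subtractf)

lemma ip_diff_right: "ip x (y - z) = ip x y - ip x z"
  by (simp add: ip_def algebra_simps sum_subtractf)

lemma ip_scale_right: "ip x (c *s y) = c * ip x y"
  by (simp add: ip_def sum_distrib_left ac_simps)

lemma ip_scaleR_right: "ip x (r *\<^sub>R y) = r *\<^sub>R ip x y"
  by (simp add: ip_def scaleR_sum_right)

lemma ip_scaleR_left: "ip (r *\<^sub>R x) y = r *\<^sub>R ip x y"
proof -
  have "cj (r *\<^sub>R z) = r *\<^sub>R cj z" for z
    unfolding cj_eq by (simp add: inner_scaleR_right algebra_simps) (simp add: scaleR_conv_of_real)
  then show ?thesis by (simp add: ip_def scaleR_sum_right)
qed

lemma cj_ip: "cj (ip x y) = ip y x"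
  by (simp add: ip_def cj_sum cj_mult mult.commute)

lemma norm_ip_commute: "norm (ip x y) = norm (ip y x)"
  using norm_cj cj_ip by metis

lemma ip_self: "ip x x = of_real ((norm x)\<^sup>2)"
  by (simp add: ip_def cj_norm norm_vec_def L2_set_def sum_nonneg)

lemma ip_inner: "ip x y + ip y x = of_real (2 * (x \<bullet> y))"
  by (simp add: ip_def inner_vec_def sum.distrib[symmetric] cj_inner sum_distrib_left del: of_real_mult)

text \<open>\<open>1 \<bullet> z\<close> serves as the real part of a scalar \<open>z\<close>. Hence
  \<open>a \<bullet> x\<close> is a real-homogeneous function of \<open>ip a x\<close>, and its
  powers can be averaged in the same way as those of \<open>norm (ip a x)\<close>.\<close>

lemma inner_one_ip: "1 \<bullet> ip x y = x \<bullet> y"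
proof -
  have "of_real (2 * (1 \<bullet> ip x y)) = (of_real (2 * (x \<bullet> y)) :: 'a)"
    using cj_inner[of 1 "ip x y"] ip_inner[of x y] by (simp add: cj_ip)
  then show ?thesis by (simp del: of_real_mult)
qed

lemma ip_axis: "ip (axis i 1) x = x $ i"
proof -
  have "ip (axis i 1) x = (\<Sum>j\<in>UNIV. if j = i then x $ j else 0)"
    unfolding ip_def by (intro sum.cong) (auto simp: axis_def)
  then show ?thesis by simp
qed

lemma continuous_on_ip [continuous_intros]:
  "continuous_on S f \<Longrightarrow> continuous_on S g \<Longrightarrow> continuous_on S (\<lambda>x. ip (f x) (g x))"
  unfolding ip_def by (intro continuous_intros)

definition adj :: "'a ^ 'n ^ 'm \<Rightarrow> 'a ^ 'm ^ 'n" where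
  "adj U = (\<chi> i j. cj (U $ j $ i))"

definition ugroup :: "('a ^ 'n ^ 'n) set" where
  "ugroup = {U. adj U ** U = mat 1 \<and> U ** adj U = mat 1}"

lemma adj_adj [simp]: "adj (adj U) = U"
  by (simp add: adj_def vec_eq_iff)

lemma adj_mult: "adj (A ** B) = adj B ** adj A"
  by (simp add: adj_def matrix_matrix_mult_def vec_eq_iff cj_sum cj_mult mult.commute)

lemma adj_mat_1 [simp]: "adj (mat 1) = mat 1"
  by (auto simp: adj_def mat_def vec_eq_iff)

lemma continuous_on_adj: "continuous_on S adj"
  unfolding adj_def by (intro continuous_intros)

lemma ip_mult_left: "ip (U *v x) y = ip x (adj U *v y)"
proof -
  have "ip (U *v x) y = (\<Sum>i\<in>UNIV. \<Sum>j\<in>UNIV. cj (U $ i $ j) * cj (x $ j) * y $ i)"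
    by (simp add: ip_def matrix_vector_mult_def cj_sum cj_mult sum_distrib_right)
  also have "\<dots> = (\<Sum>j\<in>UNIV. \<Sum>i\<in>UNIV. cj (U $ i $ j) * cj (x $ j) * y $ i)"
    by (rule sum.swap)
  also have "\<dots> = ip x (adj U *v y)"
    by (simp add: ip_def matrix_vector_mult_def adj_def sum_distrib_left ac_simps)
  finally show ?thesis .
qed

lemma ugroup_mat_1: "mat 1 \<in> ugroup"
  by (simp add: ugroup_def)

lemma ugroup_adj: "U \<in> ugroup \<Longrightarrow> adj U \<in> ugroup"
  by (simp add: ugroup_def)

lemma ugroup_mult:
  assumes "U \<in> ugroup" "V \<in> ugroup" shows "U ** V \<in> ugroup"
proof -
  have "adj (U ** V) ** (U ** V) = adj V ** (adj U ** U) ** V"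
    by (simp add: adj_mult matrix_mul_assoc)
  moreover have "(U ** V) ** adj (U ** V) = U ** (V ** adj V) ** adj U"
    by (simp add: adj_mult matrix_mul_assoc)
  ultimately show ?thesis using assms by (simp add: ugroup_def)
qed

lemma ugroup_adj_cancel:
  assumes "U \<in> ugroup" shows "adj U *v (U *v x) = x" "U *v (adj U *v x) = x"
  using assms by (simp_all add: ugroup_def matrix_vector_mul_assoc)

lemma ugroup_ip: "U \<in> ugroup \<Longrightarrow> ip (U *v x) (U *v y) = ip x y"
  by (simp add: ip_mult_left ugroup_adj_cancel)

lemma ugroup_inner: "U \<in> ugroup \<Longrightarrow> (U *v x) \<bullet> (U *v y) = x \<bullet> y"
  by (metis inner_one_ip ugroup_ip)

lemma ugroup_norm: "U \<in> ugroup \<Longrightarrow> norm (U *v x) = norm x"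
  by (simp add: norm_eq_sqrt_inner ugroup_inner)

lemma mult_scaleR: "U *v (r *\<^sub>R x) = r *\<^sub>R (U *v x)" for U :: "'a ^ 'n ^ 'm"
  by (simp add: matrix_vector_mult_def vec_eq_iff scaleR_sum_right)

lemma ugroup_orthogonal_transformation:
  assumes "U \<in> ugroup" shows "orthogonal_transformation (\<lambda>x. U *v x)"
  unfolding orthogonal_transformation_def
  using assms by (auto intro!: linearI simp: matrix_vector_right_distrib mult_scaleR ugroup_inner)

text \<open>The Householder-type reflection \<open>v \<mapsto> v - (\<langle>u, v\<rangle> / \<langle>u, x\<rangle>) u\<close> with \<open>u = x - y\<close> is unitary because
  \<open>\<langle>u, u\<rangle> = 2 Re \<langle>u, x\<rangle>\<close>.\<close>

lemma ugroup_transitive: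
  fixes x y :: "'a ^ 'n"
  assumes "norm x = 1" "norm y = 1"
  shows "\<exists>U\<in>ugroup. U *v x = y \<and> (\<forall>v. ip (x - y) v = 0 \<longrightarrow> U *v v = v)"
proof (cases "x = y")
  case True
  then show ?thesis using ugroup_mat_1 by (intro bexI[of _ "mat 1"]) auto
next
  case False
  define u where "u = x - y"
  define c where "c = ip u x"
  have uu: "ip u u = c + cj c"
  proof -
    have "ip u u = ip u x - ip u y" unfolding u_def by (rule ip_diff_right)
    moreover have "ip u y = ip x y - 1" "ip x u = 1 - ip x y"
      using assms by (simp_all add: u_def ip_diff_left ip_diff_right ip_self)
    ultimately show ?thesis by (simp add: c_def cj_ip)
  qed
  have c: "c \<noteq> 0" "cj c \<noteq> 0"
  proof -
    have "ip u u \<noteq> 0" using False by (simp add: ip_self u_def)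
    then show "c \<noteq> 0" using uu by auto
    then show "cj c \<noteq> 0" by (metis cj_cj cj_zero)
  qed
  \<comment> \<open>The denominator is left open because the adjoint of the map with denominator
    \<open>c\<close> is the one with denominator \<open>cj c\<close>. Two such maps are inverse to
    each other when their denominators add up to \<open>ip u u\<close>.\<close>
  define H where "H e = (\<chi> i j. (if i = j then 1 else 0) - u $ i * cj (u $ j) / e)" for e
  have Hv: "H e *v v = v - (ip u v / e) *s u" for e v
  proof -
    have "(H e *v v) $ i = (\<Sum>j\<in>UNIV. (if i = j then v $ j else 0) - u $ i / e * (cj (u $ j) * v $ j))" for i
      unfolding H_def matrix_vector_mult_def by (auto intro!: sum.cong simp: algebra_simps)
    then show ?thesis
      by (simp add: vec_eq_iff sum_subtractf sum_distrib_left sum_distrib_right sum_divide_distrib ip_def ac_simps)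
  qed
  have adjH: "adj (H c) = H (cj c)"
    by (simp add: H_def adj_def vec_eq_iff cj_diff cj_divide cj_mult mult.commute)
  have inv: "H e *v (H e' *v v) = v" if "e + e' = c + cj c" "e \<noteq> 0" "e' \<noteq> 0" for e e' v
  proof -
    define s where "s = ip u v"
    define t where "t = ip u (H e' *v v)"
    have t: "t = s - s / e' * (e + e')"
      by (simp add: t_def Hv ip_diff_right ip_scale_right uu that(1) s_def)
    have K: "s / e' + t / e = 0"
      unfolding t using that(2,3) by (simp add: field_simps)
    have "H e *v (H e' *v v) = H e' *v v - (t / e) *s u" by (simp add: Hv[of e] t_def)
    also have "\<dots> = v - (s / e' + t / e) *s u"
      by (simp add: Hv[of e'] s_def vec_eq_iff algebra_simps)
    also have "\<dots> = v" unfolding K by simp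
    finally show ?thesis .
  qed
  have "H c \<in> ugroup"
    unfolding ugroup_def mem_Collect_eq adjH matrix_eq
    using inv[of "cj c" c] inv[of c "cj c"] c
    by (simp add: matrix_vector_mul_assoc[symmetric] add.commute)
  moreover have "H c *v x = y" using c by (simp add: Hv c_def[symmetric]) (simp add: u_def)
  moreover have "\<forall>v. ip (x - y) v = 0 \<longrightarrow> H c *v v = v" by (simp add: Hv u_def[symmetric])
  ultimately show ?thesis by blast
qed

definition onpair :: "'a ^ 'n \<Rightarrow> 'a ^ 'n \<Rightarrow> bool" where
  "onpair x y \<longleftrightarrow> norm x = 1 \<and> norm y = 1 \<and> ip x y = 0"

lemma onpair_commute: "onpair x y \<Longrightarrow> onpair y x"
  unfolding onpair_def by (metis norm_eq_zero norm_ip_commute)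

lemma norm_axis_one: "norm (axis i 1 :: 'a ^ 'n) = 1"
  unfolding norm_eq_sqrt_inner inner_axis_axis by (simp add: power2_norm_eq_inner[symmetric])

lemma onpair_axis: "i \<noteq> j \<Longrightarrow> onpair (axis i 1) (axis j 1)"
  by (simp add: onpair_def ip_axis norm_axis_one) (simp add: axis_def)

text \<open>First carry \<open>x\<close> to \<open>x'\<close> by some \<open>U\<close>, then
  \<open>U *v y\<close> to \<open>y'\<close> by a reflection along their difference. The reflection
  leaves \<open>x'\<close> in place, since both vectors are orthogonal to it.\<close>

lemma ugroup_transitive_pair:
  assumes "onpair x y" "onpair x' y'"
  shows "\<exists>U\<in>ugroup. U *v x = x' \<and> U *v y = y'"
proof -
  obtain U where U: "U \<in> ugroup" "U *v x = x'"
    using ugroup_transitive assms unfolding onpair_def by blast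
  have n: "norm (U *v y) = 1" using U assms by (simp add: ugroup_norm onpair_def)
  obtain V where V: "V \<in> ugroup" "V *v (U *v y) = y'"
      "\<forall>v. ip (U *v y - y') v = 0 \<longrightarrow> V *v v = v"
    using ugroup_transitive n assms unfolding onpair_def by blast
  have "ip (U *v y) x' = 0"
    using onpair_commute[OF assms(1)] U ugroup_ip[OF U(1), of y x] by (simp add: onpair_def)
  moreover have "ip y' x' = 0" using onpair_commute[OF assms(2)] by (simp add: onpair_def)
  ultimately have "V *v x' = x'" using V by (simp add: ip_diff_left)
  then show ?thesis using U V ugroup_mult[OF V(1) U(1)]
    by (intro bexI[of _ "V ** U"]) (auto simp: matrix_vector_mul_assoc[symmetric])
qed

end

section \<open>Invariance of Haar measure\<close>

locale haar_action = conj_field cj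
  for cj :: "'a::{real_normed_field,euclidean_space} \<Rightarrow> 'a" +
  fixes \<mu> :: "('a ^ 'n::finite ^ 'n) measure"
  assumes haar: "normalized_haar ugroup \<mu>"
begin

lemma prob_space_\<mu>: "prob_space \<mu>"
  using haar by (simp add: normalized_haar_def)

lemma sets_\<mu>: "sets \<mu> = sets (restrict_space borel ugroup)"
  using haar by (simp add: normalized_haar_def)

lemma space_\<mu>: "space \<mu> = ugroup"
  using sets_eq_imp_space_eq[OF sets_\<mu>] by (simp add: space_restrict_space)

lemma measurable_\<mu>_iff: "f \<in> N \<rightarrow>\<^sub>M \<mu> \<longleftrightarrow> f \<in> N \<rightarrow>\<^sub>M borel \<and> f \<in> space N \<rightarrow> ugroup"
  unfolding measurable_cong_sets[OF refl sets_\<mu>]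
  by (auto simp: measurable_restrict_space2_iff)

lemma measurable_matrix_mult [measurable]:
  assumes "f \<in> N \<rightarrow>\<^sub>M \<mu>" "g \<in> N \<rightarrow>\<^sub>M \<mu>" shows "(\<lambda>x. f x ** g x) \<in> N \<rightarrow>\<^sub>M \<mu>"
proof -
  have "continuous_on UNIV (\<lambda>p :: ('a ^ 'n ^ 'n) \<times> ('a ^ 'n ^ 'n). fst p ** snd p)"
    unfolding matrix_matrix_mult_def by (intro continuous_intros)
  then have "(\<lambda>x. f x ** g x) \<in> N \<rightarrow>\<^sub>M borel"
    using assms by (intro borel_measurable_continuous_Pair[where H = "(**)"]) (simp_all add: measurable_\<mu>_iff)
  then show ?thesis using assms by (auto simp: measurable_\<mu>_iff Pi_iff ugroup_mult)
qed

lemma measurable_adj [measurable]: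
  assumes "f \<in> N \<rightarrow>\<^sub>M \<mu>" shows "(\<lambda>x. adj (f x)) \<in> N \<rightarrow>\<^sub>M \<mu>"
  using assms borel_measurable_continuous_on[OF continuous_on_adj, of f N]
  by (auto simp: measurable_\<mu>_iff ugroup_adj Pi_iff)

lemma measurable_matrix_vector_mult [measurable]:
  assumes "f \<in> N \<rightarrow>\<^sub>M \<mu>" "g \<in> N \<rightarrow>\<^sub>M borel" shows "(\<lambda>x. f x *v g x) \<in> N \<rightarrow>\<^sub>M borel"
proof -
  have "continuous_on UNIV (\<lambda>p :: ('a ^ 'n ^ 'n) \<times> ('a ^ 'n). fst p *v snd p)"
    unfolding matrix_vector_mult_def by (intro continuous_intros)
  then show ?thesis using assms
    by (intro borel_measurable_continuous_Pair[where H = "(*v)"]) (simp_all add: measurable_\<mu>_iff)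
qed

text \<open>Haar invariance is assumed for images of sets; the preimage under translation by
  \<open>g\<close> is the image under translation by its inverse \<open>adj g\<close>.\<close>

lemma distr_left_mult:
  assumes g: "g \<in> ugroup" shows "distr \<mu> \<mu> (\<lambda>R. g ** R) = \<mu>"
proof (rule measure_eqI)
  fix S assume "S \<in> sets (distr \<mu> \<mu> (\<lambda>R. g ** R))"
  then have S: "S \<in> sets \<mu>" by simp
  have [measurable]: "(\<lambda>_. g) \<in> \<mu> \<rightarrow>\<^sub>M \<mu>" using g by (simp add: space_\<mu>)
  have SG: "S \<subseteq> ugroup" using sets.sets_into_space[OF S] space_\<mu> by simp
  have eq: "(\<lambda>R. g ** R) -` S \<inter> space \<mu> = (\<lambda>R. adj g ** R) ` S"
  proof (intro set_eqI iffI)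
    fix R assume "R \<in> (\<lambda>R. g ** R) -` S \<inter> space \<mu>"
    moreover have "R = adj g ** (g ** R)" using g by (simp add: matrix_mul_assoc ugroup_def)
    ultimately show "R \<in> (\<lambda>R. adj g ** R) ` S" by blast
  next
    fix R assume "R \<in> (\<lambda>R. adj g ** R) ` S"
    then obtain T where T: "T \<in> S" "R = adj g ** T" by blast
    moreover have "g ** R = T" using g T by (simp add: matrix_mul_assoc ugroup_def)
    ultimately show "R \<in> (\<lambda>R. g ** R) -` S \<inter> space \<mu>"
      using SG g ugroup_mult ugroup_adj by (auto simp: space_\<mu>)
  qed
  have "emeasure (distr \<mu> \<mu> (\<lambda>R. g ** R)) S = emeasure \<mu> ((\<lambda>R. adj g ** R) ` S)"
    using S by (subst emeasure_distr) (auto simp: eq)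
  also have "\<dots> = emeasure \<mu> S"
    using haar S ugroup_adj[OF g] by (simp add: normalized_haar_def)
  finally show "emeasure (distr \<mu> \<mu> (\<lambda>R. g ** R)) S = emeasure \<mu> S" .
qed simp

lemma nn_integral_left_mult:
  assumes g: "g \<in> ugroup" and [measurable]: "\<phi> \<in> borel_measurable \<mu>"
  shows "(\<integral>\<^sup>+R. \<phi> (g ** R) \<partial>\<mu>) = (\<integral>\<^sup>+R. \<phi> R \<partial>\<mu>)"
proof -
  have [measurable]: "(\<lambda>_. g) \<in> \<mu> \<rightarrow>\<^sub>M \<mu>" using g by (simp add: space_\<mu>)
  have "(\<integral>\<^sup>+R. \<phi> R \<partial>\<mu>) = (\<integral>\<^sup>+R. \<phi> R \<partial>distr \<mu> \<mu> (\<lambda>R. g ** R))" by (simp add: distr_left_mult[OF g])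
  also have "\<dots> = (\<integral>\<^sup>+R. \<phi> (g ** R) \<partial>\<mu>)" by (rule nn_integral_distr) auto
  finally show ?thesis by simp
qed

text \<open>Haar measure is invariant under inversion, hence also right invariant: integrate \<open>\<phi> (g\<^sup>-\<^sup>1 h)\<close> in both orders.\<close>

lemma nn_integral_adj:
  assumes [measurable]: "\<phi> \<in> borel_measurable \<mu>"
  shows "(\<integral>\<^sup>+R. \<phi> (adj R) \<partial>\<mu>) = (\<integral>\<^sup>+R. \<phi> R \<partial>\<mu>)"
proof -
  interpret \<mu>: prob_space \<mu> by (rule prob_space_\<mu>)
  interpret pair_sigma_finite \<mu> \<mu> ..
  have "(\<integral>\<^sup>+R. \<phi> R \<partial>\<mu>) = (\<integral>\<^sup>+g. \<integral>\<^sup>+h. \<phi> (adj g ** h) \<partial>\<mu> \<partial>\<mu>)"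
  proof -
    have "(\<integral>\<^sup>+g. \<integral>\<^sup>+h. \<phi> (adj g ** h) \<partial>\<mu> \<partial>\<mu>) = (\<integral>\<^sup>+g. \<integral>\<^sup>+h. \<phi> h \<partial>\<mu> \<partial>\<mu>)"
      by (rule nn_integral_cong) (simp add: nn_integral_left_mult ugroup_adj space_\<mu>)
    then show ?thesis by (simp add: \<mu>.emeasure_space_1)
  qed
  also have "\<dots> = (\<integral>\<^sup>+h. \<integral>\<^sup>+g. \<phi> (adj g ** h) \<partial>\<mu> \<partial>\<mu>)"
    by (rule Fubini'[symmetric]) measurable
  also have "\<dots> = (\<integral>\<^sup>+h. \<integral>\<^sup>+g. \<phi> (adj g) \<partial>\<mu> \<partial>\<mu>)"
  proof (rule nn_integral_cong)
    fix h assume "h \<in> space \<mu>"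
    then have h: "adj h \<in> ugroup" using ugroup_adj by (simp add: space_\<mu>)
    have "(\<integral>\<^sup>+g. \<phi> (adj g ** h) \<partial>\<mu>) = (\<integral>\<^sup>+g. \<phi> (adj (adj h ** g)) \<partial>\<mu>)"
      by (simp add: adj_mult)
    then show "(\<integral>\<^sup>+g. \<phi> (adj g ** h) \<partial>\<mu>) = (\<integral>\<^sup>+g. \<phi> (adj g) \<partial>\<mu>)"
      using nn_integral_left_mult[OF h, of "\<lambda>g. \<phi> (adj g)"] by simp
  qed
  also have "\<dots> = (\<integral>\<^sup>+g. \<phi> (adj g) \<partial>\<mu>)" by (simp add: \<mu>.emeasure_space_1)
  finally show ?thesis by simp
qed

lemma nn_integral_right_mult:
  assumes g: "g \<in> ugroup" and [measurable]: "\<phi> \<in> borel_measurable \<mu>"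
  shows "(\<integral>\<^sup>+R. \<phi> (R ** g) \<partial>\<mu>) = (\<integral>\<^sup>+R. \<phi> R \<partial>\<mu>)"
proof -
  have [measurable]: "(\<lambda>_. g) \<in> \<mu> \<rightarrow>\<^sub>M \<mu>" using g by (simp add: space_\<mu>)
  have "(\<integral>\<^sup>+R. \<phi> (R ** g) \<partial>\<mu>) = (\<integral>\<^sup>+R. \<phi> (adj R ** g) \<partial>\<mu>)"
    using nn_integral_adj[of "\<lambda>R. \<phi> (R ** g)"] by simp
  also have "\<dots> = (\<integral>\<^sup>+R. \<phi> (adj (adj g ** R)) \<partial>\<mu>)" by (simp add: adj_mult)
  also have "\<dots> = (\<integral>\<^sup>+R. \<phi> R \<partial>\<mu>)"
    using nn_integral_left_mult[OF ugroup_adj[OF g], of "\<lambda>g. \<phi> (adj g)"] nn_integral_adj by simp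
  finally show ?thesis .
qed

lemma distr_right_mult:
  assumes g: "g \<in> ugroup" shows "distr \<mu> \<mu> (\<lambda>R. R ** g) = \<mu>"
proof (rule measure_eqI)
  fix S assume "S \<in> sets (distr \<mu> \<mu> (\<lambda>R. R ** g))"
  then have [measurable]: "S \<in> sets \<mu>" by simp
  have [measurable]: "(\<lambda>_. g) \<in> \<mu> \<rightarrow>\<^sub>M \<mu>" using g by (simp add: space_\<mu>)
  have "emeasure (distr \<mu> \<mu> (\<lambda>R. R ** g)) S = (\<integral>\<^sup>+R. indicator S R \<partial>distr \<mu> \<mu> (\<lambda>R. R ** g))" by simp
  also have "\<dots> = (\<integral>\<^sup>+R. indicator S (R ** g) \<partial>\<mu>)" by (rule nn_integral_distr) auto
  also have "\<dots> = emeasure \<mu> S" by (subst nn_integral_right_mult[OF g]) auto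
  finally show "emeasure (distr \<mu> \<mu> (\<lambda>R. R ** g)) S = emeasure \<mu> S" .
qed simp

lemma integral_left_mult:
  fixes \<phi> :: "'a ^ 'n ^ 'n \<Rightarrow> real"
  assumes g: "g \<in> ugroup" and [measurable]: "\<phi> \<in> borel_measurable \<mu>"
  shows "(\<integral>R. \<phi> (g ** R) \<partial>\<mu>) = (\<integral>R. \<phi> R \<partial>\<mu>)"
proof -
  have [measurable]: "(\<lambda>_. g) \<in> \<mu> \<rightarrow>\<^sub>M \<mu>" using g by (simp add: space_\<mu>)
  have "(\<integral>R. \<phi> R \<partial>\<mu>) = (\<integral>R. \<phi> R \<partial>distr \<mu> \<mu> (\<lambda>R. g ** R))" by (simp add: distr_left_mult[OF g])
  also have "\<dots> = (\<integral>R. \<phi> (g ** R) \<partial>\<mu>)" by (rule integral_distr) auto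
  finally show ?thesis by simp
qed

lemma integral_right_mult:
  fixes \<phi> :: "'a ^ 'n ^ 'n \<Rightarrow> real"
  assumes g: "g \<in> ugroup" and [measurable]: "\<phi> \<in> borel_measurable \<mu>"
  shows "(\<integral>R. \<phi> (R ** g) \<partial>\<mu>) = (\<integral>R. \<phi> R \<partial>\<mu>)"
proof -
  have [measurable]: "(\<lambda>_. g) \<in> \<mu> \<rightarrow>\<^sub>M \<mu>" using g by (simp add: space_\<mu>)
  have "(\<integral>R. \<phi> R \<partial>\<mu>) = (\<integral>R. \<phi> R \<partial>distr \<mu> \<mu> (\<lambda>R. R ** g))" by (simp add: distr_right_mult[OF g])
  also have "\<dots> = (\<integral>R. \<phi> (R ** g) \<partial>\<mu>)" by (rule integral_distr) auto
  finally show ?thesis by simp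
qed

text \<open>Right multiplication by a unitary matrix that carries one pair to the other turns one
  integrand into the other.\<close>

lemma integral_pair_law:
  fixes f g :: "'a ^ 'n \<Rightarrow> real"
  assumes "onpair x y" "onpair x' y'"
    and [measurable]: "f \<in> borel_measurable borel" "g \<in> borel_measurable borel"
  shows "(\<integral>R. f (R *v x) * g (R *v y) \<partial>\<mu>) = (\<integral>R. f (R *v x') * g (R *v y') \<partial>\<mu>)"
proof -
  obtain U where U: "U \<in> ugroup" "U *v x = x'" "U *v y = y'"
    using ugroup_transitive_pair assms by blast
  show ?thesis
    using integral_right_mult[OF U(1), of "\<lambda>R. f (R *v x) * g (R *v y)"] U
    by (simp add: matrix_vector_mul_assoc[symmetric])
qed

lemma integral_single_law:
  fixes f :: "'a ^ 'n \<Rightarrow> real"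
  assumes "norm x = 1" "norm x' = 1" and [measurable]: "f \<in> borel_measurable borel"
  shows "(\<integral>R. f (R *v x) \<partial>\<mu>) = (\<integral>R. f (R *v x') \<partial>\<mu>)"
proof -
  obtain U where U: "U \<in> ugroup" "U *v x = x'" using ugroup_transitive assms by blast
  show ?thesis
    using integral_right_mult[OF U(1), of "\<lambda>R. f (R *v x)"] U
    by (simp add: matrix_vector_mul_assoc[symmetric])
qed

text \<open>Integrate the indicator of \<open>R *v y\<close> in \<open>A\<close> over Haar
  \<open>R\<close> and uniform \<open>y\<close>. For fixed \<open>y\<close>, transitivity and right
  invariance give the orbit law of \<open>x\<close>; for fixed \<open>R\<close>, isometry invariance
  gives the uniform measure of \<open>A\<close>. Fubini equates the two.\<close>

lemma sphere_uniform_eq_orbit_law: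
  fixes x :: "'a ^ 'n"
  assumes x: "norm x = 1" and A: "A \<in> sets borel" "A \<subseteq> sphere 0 1"
  shows "measure sphere_uniform A = measure \<mu> {R \<in> space \<mu>. R *v x \<in> A}"
proof -
  interpret \<mu>: prob_space \<mu> by (rule prob_space_\<mu>)
  interpret S: prob_space "sphere_uniform :: ('a ^ 'n) measure" by (rule prob_space_sphere_uniform)
  interpret pair_sigma_finite "sphere_uniform :: ('a ^ 'n) measure" \<mu> ..
  have [measurable]: "A \<in> sets borel" by fact
  have [measurable]: "(\<lambda>y. y) \<in> sphere_uniform \<rightarrow>\<^sub>M (borel :: ('a ^ 'n) measure)"
    unfolding measurable_cong_sets[OF sets_sphere_uniform refl] by (rule measurable_restrict_space1) simp
  let ?c = "\<integral>\<^sup>+R. indicator A (R *v x) \<partial>\<mu>"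
  have "(\<integral>\<^sup>+y. \<integral>\<^sup>+R. indicator A (R *v y) \<partial>\<mu> \<partial>sphere_uniform) = (\<integral>\<^sup>+y. ?c \<partial>(sphere_uniform :: ('a ^ 'n) measure))"
  proof (rule nn_integral_cong)
    fix y :: "'a ^ 'n" assume "y \<in> space sphere_uniform"
    then have "norm y = 1" by simp
    then obtain U where U: "U \<in> ugroup" "U *v x = y" using ugroup_transitive x by blast
    then show "(\<integral>\<^sup>+R. indicator A (R *v y) \<partial>\<mu>) = ?c"
      using nn_integral_right_mult[OF U(1), of "\<lambda>R. indicator A (R *v x)"]
      by (simp add: matrix_vector_mul_assoc[symmetric])
  qed
  moreover have "(\<integral>\<^sup>+y. \<integral>\<^sup>+R. indicator A (R *v y) \<partial>\<mu> \<partial>sphere_uniform) =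
      (\<integral>\<^sup>+R. \<integral>\<^sup>+y. indicator A (R *v y) \<partial>sphere_uniform \<partial>\<mu>)"
    by (rule Fubini'[symmetric]) measurable
  moreover have "\<dots> = (\<integral>\<^sup>+R. emeasure sphere_uniform A \<partial>\<mu>)"
  proof (rule nn_integral_cong)
    fix R assume "R \<in> space \<mu>"
    then have R: "orthogonal_transformation (\<lambda>y. R *v y)"
      using ugroup_orthogonal_transformation by (simp add: space_\<mu>)
    have "(\<lambda>y. R *v y) -` A \<in> sets sphere_uniform"
    proof -
      have "continuous_on UNIV (\<lambda>y. R *v y)"
        unfolding matrix_vector_mult_def by (intro continuous_intros)
      then have "(\<lambda>y. R *v y) -` A \<in> sets borel"
        using A measurable_sets_borel borel_measurable_continuous_onI by blast
      then show ?thesis using A orthogonal_transformation_norm[OF R] by (auto simp: sets_restrict_space_iff)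
    qed
    moreover have "indicator A (R *v y) = (indicator ((\<lambda>y. R *v y) -` A) y :: ennreal)" for y
      by (auto simp: indicator_def)
    ultimately show "(\<integral>\<^sup>+y. indicator A (R *v y) \<partial>sphere_uniform) = emeasure sphere_uniform A"
      using emeasure_sphere_uniform_isometry[OF R A] by simp
  qed
  moreover have "?c = emeasure \<mu> {R \<in> space \<mu>. R *v x \<in> A}"
  proof -
    have "?c = (\<integral>\<^sup>+R. indicator {R \<in> space \<mu>. R *v x \<in> A} R \<partial>\<mu>)"
      by (intro nn_integral_cong) (auto simp: indicator_def)
    also have "\<dots> = emeasure \<mu> {R \<in> space \<mu>. R *v x \<in> A}"
      by (rule nn_integral_indicator) measurable
    finally show ?thesis .
  qed
  ultimately have "emeasure sphere_uniform A = emeasure \<mu> {R \<in> space \<mu>. R *v x \<in> A}"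
    by (simp add: \<mu>.emeasure_space_1 S.emeasure_space_1[simplified])
  then show ?thesis by (simp add: measure_def)
qed

end

section \<open>The correlation of two orthogonal directions\<close>

text \<open>Regularity places \<open>A\<close> between a compact \<open>K\<close> and an open
  \<open>U\<close> of nearly equal measure. A Urysohn function for them differs from the indicator
  only on \<open>U - K\<close>.\<close>

lemma borel_indicator_approx:
  fixes M :: "'v::euclidean_space measure"
  assumes M: "prob_space M" "sets M = sets borel" and A: "A \<in> sets borel" and \<eta>: "\<eta> > 0"
  obtains g where "continuous_on UNIV g" "\<And>x. 0 \<le> g x" "\<And>x. g x \<le> (1::real)"
    "(\<integral>x. \<bar>indicator A x - g x\<bar> \<partial>M) \<le> \<eta>"
proof -
  interpret prob_space M by fact
  have fin: "emeasure M (space M) \<noteq> \<infinity>" by simp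
  have AM: "emeasure M A = ennreal (measure M A)" by (rule emeasure_eq_measure)
  have "\<exists>K\<in>{K. K \<subseteq> A \<and> compact K}. measure M A - \<eta> / 2 < measure M K"
  \<comment> \<open>\<open>ennreal\<close> truncates negative numbers to 0, so a negative threshold
    is treated apart, with the empty set as \<open>K\<close>.\<close>
  proof (cases "measure M A - \<eta> / 2 < 0")
    case True
    then show ?thesis by (intro bexI[of _ "{}"]) auto
  next
    case False
    have "ennreal (measure M A - \<eta> / 2) < emeasure M A"
      unfolding AM using \<eta> False by (intro ennreal_lessI) auto
    also have "emeasure M A = (SUP K \<in> {K. K \<subseteq> A \<and> compact K}. emeasure M K)"
      by (rule inner_regular[OF M(2) fin A])
    finally obtain K where K: "K \<subseteq> A" "compact K" "ennreal (measure M A - \<eta> / 2) < emeasure M K"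
      by (auto simp: less_SUP_iff)
    then show ?thesis using False by (auto simp: emeasure_eq_measure ennreal_less_iff)
  qed
  then obtain K where K: "K \<subseteq> A" "compact K" "measure M A - \<eta> / 2 < measure M K" by blast
  have "(INF U \<in> {U. A \<subseteq> U \<and> open U}. emeasure M U) = ennreal (measure M A)"
    using outer_regular[OF M(2) fin A] AM by simp
  also have "\<dots> < ennreal (measure M A + \<eta> / 2)" using \<eta> by (intro ennreal_lessI) (auto intro: add_nonneg_pos)
  finally obtain U where U: "A \<subseteq> U" "open U" "emeasure M U < ennreal (measure M A + \<eta> / 2)"
    by (auto simp: INF_less_iff)
  have U': "measure M U < measure M A + \<eta> / 2"
    using U(3) by (simp add: emeasure_eq_measure ennreal_less_iff)
  have "closed K" "closed (- U)" "K \<inter> - U = {}"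
    using K(1,2) U(1,2) compact_imp_closed by auto
  then obtain g :: "'v \<Rightarrow> real" where g: "continuous_on UNIV g" "\<And>x. g x \<in> closed_segment 1 0"
      "\<And>x. x \<in> K \<Longrightarrow> g x = 1" "\<And>x. x \<in> - U \<Longrightarrow> g x = 0"
    using Urysohn[of K "- U" "1::real" 0] by blast
  have g01: "0 \<le> g x" "g x \<le> 1" for x using g(2)[of x] by (auto simp: closed_segment_eq_real_ivl split: if_splits)
  have [measurable]: "K \<in> sets M" "U \<in> sets M" "A \<in> sets M"
    using M(2) A U(2) K(2) by (auto intro: borel_compact)
  have [measurable]: "g \<in> borel_measurable M"
    using borel_measurable_continuous_onI[OF g(1)] M(2) measurable_cong_sets by blast
  have "(\<integral>x. \<bar>indicator A x - g x\<bar> \<partial>M) \<le> (\<integral>x. indicator (U - K) x \<partial>M)"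
  proof (rule integral_mono)
    show "\<bar>indicator A x - g x\<bar> \<le> indicator (U - K) x" for x
      using K(1) U(1) g(3)[of x] g(4)[of x] g01[of x] by (auto simp: indicator_def)
    show "integrable M (\<lambda>x. \<bar>indicator A x - g x\<bar>)"
      using g01 by (intro integrable_const_bound[where B = 1] AE_I2) (auto simp: indicator_def)
    show "integrable M (indicator (U - K) :: 'v \<Rightarrow> real)"
      by (intro integrable_const_bound[where B = 1] AE_I2) (auto simp: indicator_def)
  qed
  also have "\<dots> = measure M U - measure M K"
    using K(1) U(1) by (simp add: finite_measure_Diff)
  also have "\<dots> \<le> \<eta>" using K(3) U' by linarith
  finally show ?thesis using that g(1) g01 by blast
qed

text \<open>Keep one factor of each power and bound the remaining \<open>p - 1\<close> factors by
  the whole sum.\<close>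

lemma sum_power_le_power_sum:
  fixes a :: "'b \<Rightarrow> real"
  assumes "\<And>j. j \<in> J \<Longrightarrow> a j \<ge> 0" "p \<ge> 1" "finite J"
  shows "(\<Sum>j\<in>J. a j ^ p) \<le> (\<Sum>j\<in>J. a j) ^ p"
proof -
  obtain q where p: "p = Suc q" using assms(2) by (cases p) auto
  have "a j ^ p \<le> a j * (sum a J) ^ q" if j: "j \<in> J" for j
  proof -
    have "a j \<le> sum a J" using j assms(1,3) by (rule member_le_sum) auto
    then have "a j ^ q \<le> (sum a J) ^ q" using assms(1)[OF j] by (rule power_mono)
    then show ?thesis unfolding p power_Suc using assms(1)[OF j] by (rule mult_left_mono)
  qed
  then have "(\<Sum>j\<in>J. a j ^ p) \<le> (\<Sum>j\<in>J. a j * (sum a J) ^ q)" by (rule sum_mono)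
  also have "\<dots> = sum a J ^ p" unfolding p power_Suc by (rule sum_distrib_right[symmetric])
  finally show ?thesis .
qed

text \<open>Two distinct indices supply a concrete orthonormal pair; by
  \<open>integral_pair_law\<close> the integrals do not depend on this choice.\<close>

locale haar_pair = haar_action cj \<mu>
  for cj :: "'a::{real_normed_field,euclidean_space} \<Rightarrow> 'a" and \<mu> :: "('a ^ 'n::finite ^ 'n) measure" +
  fixes i1 i2 :: 'n
  assumes i12: "i1 \<noteq> i2"
begin

sublocale \<mu>: prob_space \<mu> by (rule prob_space_\<mu>)

abbreviation e1 :: "'a ^ 'n" where "e1 \<equiv> axis i1 1"
abbreviation e2 :: "'a ^ 'n" where "e2 \<equiv> axis i2 1"

lemma onpair_e: "onpair e1 e2"
  using i12 by (rule onpair_axis)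

lemma norm_e [simp]: "norm e1 = 1" "norm e2 = 1"
  using onpair_e by (auto simp: onpair_def)

lemma integrable_orbit:
  assumes [measurable]: "\<phi> \<in> borel_measurable \<mu>" and "\<And>R. R \<in> ugroup \<Longrightarrow> \<bar>\<phi> R\<bar> \<le> (C::real)"
  shows "integrable \<mu> \<phi>"
  using assms(2) by (intro \<mu>.integrable_const_bound[where B = C]) (auto simp: space_\<mu>)

lemma continuous_bounded:
  fixes f :: "'a ^ 'n \<Rightarrow> real"
  assumes "continuous_on UNIV f"
  obtains C where "C \<ge> 0" "\<And>x. norm x \<le> 1 \<Longrightarrow> \<bar>f x\<bar> \<le> C"
proof -
  have "bounded (f ` cball 0 1)"
    using assms compact_cball by (intro compact_imp_bounded compact_continuous_image) (auto intro: continuous_on_subset)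
  then obtain C where "\<forall>x\<in>cball 0 1. \<bar>f x\<bar> \<le> C" by (auto simp: bounded_iff)
  then show ?thesis using that[of "\<bar>C\<bar>"] by force
qed

lemma measurable_continuous: "continuous_on UNIV f \<Longrightarrow> f \<in> borel_measurable borel"
  for f :: "'a ^ 'n \<Rightarrow> real"
  by (rule borel_measurable_continuous_onI)

lemma integrable_pair:
  fixes f g :: "'a ^ 'n \<Rightarrow> real"
  assumes f: "continuous_on UNIV f" and g: "continuous_on UNIV g" and "norm x = 1" "norm y = 1"
  shows "integrable \<mu> (\<lambda>R. f (R *v x) * g (R *v y))"
proof -
  note [measurable] = measurable_continuous[OF f] measurable_continuous[OF g]
  obtain C where C: "C \<ge> 0" "\<And>x. norm x \<le> 1 \<Longrightarrow> \<bar>f x\<bar> \<le> C" using continuous_bounded[OF f] by blast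
  obtain D where D: "D \<ge> 0" "\<And>x. norm x \<le> 1 \<Longrightarrow> \<bar>g x\<bar> \<le> D" using continuous_bounded[OF g] by blast
  show ?thesis using assms C D
    by (intro integrable_orbit[where C = "C * D"]) (auto simp: abs_mult ugroup_norm intro!: mult_mono)
qed

section \<open>The forms \<open>B\<close> and \<open>Q\<close> on continuous functions\<close>

definition CF :: "('a ^ 'n \<Rightarrow> real) set" where "CF = {f. continuous_on UNIV f}"

definition Bf :: "('a ^ 'n \<Rightarrow> real) \<Rightarrow> ('a ^ 'n \<Rightarrow> real) \<Rightarrow> real" where
  "Bf f g = (\<integral>R. f (R *v e1) * g (R *v e1) \<partial>\<mu>)"

definition Qf :: "('a ^ 'n \<Rightarrow> real) \<Rightarrow> ('a ^ 'n \<Rightarrow> real) \<Rightarrow> real" where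
  "Qf f g = (\<integral>R. f (R *v e1) * g (R *v e2) \<partial>\<mu>)"

sublocale form_pair CF Bf Qf "1 / (real CARD('n) - 1)"
proof
  show "(\<lambda>_. c) \<in> CF" for c by (simp add: CF_def)
  show "(\<lambda>x. f x + c * g x) \<in> CF" if "f \<in> CF" "g \<in> CF" for f g c
    using that by (auto simp: CF_def intro!: continuous_intros)
  show "Bf (\<lambda>x. f x + c * g x) h = Bf f h + c * Bf g h" if "f \<in> CF" "g \<in> CF" "h \<in> CF" for f g h c
    using that unfolding Bf_def CF_def
    by (simp add: distrib_right mult.assoc integrable_pair)
  show "Qf (\<lambda>x. f x + c * g x) h = Qf f h + c * Qf g h" if "f \<in> CF" "g \<in> CF" "h \<in> CF" for f g h c
    using that unfolding Qf_def CF_def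
    by (simp add: distrib_right mult.assoc integrable_pair)
  show "Bf f g = Bf g f" for f g unfolding Bf_def by (simp add: mult.commute)
  show "Qf f g = Qf g f" if "f \<in> CF" "g \<in> CF" for f g
  proof -
    \<comment> \<open>The swapped pair is orthonormal too.\<close>
    have "Qf f g = (\<integral>R. f (R *v e2) * g (R *v e1) \<partial>\<mu>)"
      unfolding Qf_def using that
      by (intro integral_pair_law onpair_e onpair_commute measurable_continuous) (auto simp: CF_def)
    then show ?thesis by (simp add: Qf_def mult.commute)
  qed
  show "Bf f f \<ge> 0" for f unfolding Bf_def by (intro Bochner_Integration.integral_nonneg) auto
  show "Bf (\<lambda>_. 1) (\<lambda>_. 1) = 1" by (simp add: Bf_def \<mu>.prob_space)
  show "Qf f (\<lambda>_. 1) = Bf f (\<lambda>_. 1)" for f by (simp add: Bf_def Qf_def)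
qed

section \<open>Averages over directions orthogonal to the first basis vector\<close>

definition zero_i1 :: "'a ^ 'n \<Rightarrow> 'a ^ 'n" where
  "zero_i1 x = (\<chi> i. if i = i1 then 0 else x $ i)"

text \<open>\<open>zero_i1\<close> is the orthogonal projection to the complement of
  \<open>e1\<close>, hence self-adjoint.\<close>

lemma ip_zero_i1: "ip v (zero_i1 x) = ip (zero_i1 v) x"
  unfolding ip_def zero_i1_def by (intro sum.cong) auto

lemma norm_vec_sq: "(norm x)\<^sup>2 = (\<Sum>i\<in>UNIV. (norm (x $ i))\<^sup>2)" for x :: "'a ^ 'n"
  by (simp add: norm_vec_def L2_set_def sum_nonneg)

lemma norm_zero_i1_sum: "(norm (zero_i1 x))\<^sup>2 = (\<Sum>i\<in>UNIV - {i1}. (norm (x $ i))\<^sup>2)"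
  unfolding norm_vec_sq by (subst sum.remove[of UNIV i1]) (auto simp: zero_i1_def intro!: sum.cong)

lemma norm_zero_i1: "(norm (zero_i1 x))\<^sup>2 = (norm x)\<^sup>2 - (norm (x $ i1))\<^sup>2"
  using sum.remove[of UNIV i1 "\<lambda>i. (norm (x $ i))\<^sup>2"] by (simp only: norm_zero_i1_sum norm_vec_sq[of x]) simp

lemma norm_zero_i1_le: "norm (zero_i1 x) \<le> norm x"
proof (rule power2_le_imp_le)
  show "(norm (zero_i1 x))\<^sup>2 \<le> (norm x)\<^sup>2" unfolding norm_zero_i1 by simp
qed simp

lemma zero_i1_orthogonal: "ip e1 (zero_i1 x) = 0"
  by (simp add: ip_axis zero_i1_def)

lemma continuous_on_zero_i1 [continuous_intros]:
  assumes "continuous_on S f" shows "continuous_on S (\<lambda>x. zero_i1 (f x))"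
  unfolding zero_i1_def
proof (rule continuous_on_vec_lambda)
  show "continuous_on S (\<lambda>x. if i = i1 then 0 else f x $ i)" for i
    using assms by (cases "i = i1") (simp_all add: continuous_on_component)
qed

lemma measurable_zero_i1 [measurable]: "zero_i1 \<in> borel_measurable borel"
  using continuous_on_zero_i1[OF continuous_on_id] by (rule borel_measurable_continuous_onI)

text \<open>Left invariance moves the functional \<open>ip w\<close>, whereas
  \<open>integral_single_law\<close> moves the vector by right invariance.\<close>

lemma integral_functional_law:
  fixes \<phi> :: "'a \<Rightarrow> real"
  assumes w: "norm w = 1" "norm w' = 1" and [measurable]: "\<phi> \<in> borel_measurable borel"
  shows "(\<integral>R. \<phi> (ip w (R *v e1)) \<partial>\<mu>) = (\<integral>R. \<phi> (ip w' (R *v e1)) \<partial>\<mu>)"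
proof -
  obtain U where U: "U \<in> ugroup" "U *v w = w'" using ugroup_transitive w by blast
  have [measurable]: "(\<lambda>x. ip w' x) \<in> borel_measurable borel"
    by (intro borel_measurable_continuous_onI continuous_intros)
  have "(\<integral>R. \<phi> (ip w' (R *v e1)) \<partial>\<mu>) = (\<integral>R. \<phi> (ip w' ((U ** R) *v e1)) \<partial>\<mu>)"
    by (rule integral_left_mult[OF U(1), symmetric]) measurable
  also have "\<dots> = (\<integral>R. \<phi> (ip w (R *v e1)) \<partial>\<mu>)"
    by (simp add: matrix_vector_mul_assoc[symmetric] U(2)[symmetric] ugroup_ip[OF U(1)])
  finally show ?thesis by simp
qed

lemma homogeneous_moment:
  fixes \<phi> :: "'a \<Rightarrow> real"
  assumes \<phi>: "continuous_on UNIV \<phi>" "\<And>r s. r \<ge> 0 \<Longrightarrow> \<phi> (r *\<^sub>R s) = r ^ n * \<phi> s" and n: "n > 0"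
  shows "(\<integral>R. \<phi> (ip w (R *v e1)) \<partial>\<mu>) = norm w ^ n * (\<integral>R. \<phi> ((R *v e1) $ i2) \<partial>\<mu>)"
proof (cases "w = 0")
  case True
  \<comment> \<open>Zero is written as a multiple by 0 so that homogeneity of positive degree makes
    \<open>\<phi>\<close> vanish there.\<close>
  then have "ip w x = 0 *\<^sub>R 0" for x by (simp add: ip_def)
  then have "\<phi> (ip w x) = 0" for x using \<phi>(2)[of 0 0] n by (simp add: power_0_left)
  then show ?thesis using True n by simp
next
  case False
  have [measurable]: "\<phi> \<in> borel_measurable borel" using \<phi>(1) by (rule borel_measurable_continuous_onI)
  define v where "v = w /\<^sub>R norm w"
  have v: "norm v = 1" "w = norm w *\<^sub>R v" using False by (auto simp: v_def)
  have "\<phi> (ip w x) = norm w ^ n * \<phi> (ip v x)" for x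
    by (subst v(2)) (simp add: ip_scaleR_left \<phi>(2))
  then show ?thesis
    using integral_functional_law[OF v(1) norm_e(2), of \<phi>] by (simp add: ip_axis)
qed

text \<open>Given \<open>R e1\<close>, the vector \<open>R e2\<close> may be replaced by \<open>R \<eta>\<close> for an independent random unit vector \<open>\<eta>\<close>
  orthogonal to \<open>e1\<close>; homogeneity of \<open>\<phi>\<close> lets us use an unnormalized one, the projection of \<open>R' e1\<close>.\<close>

lemma orthogonal_average:
  fixes \<phi> :: "'a \<Rightarrow> real"
  assumes \<phi>: "continuous_on UNIV \<phi>" "\<And>r s. r \<ge> 0 \<Longrightarrow> \<phi> (r *\<^sub>R s) = r ^ n * \<phi> s" and n: "n > 0"
    and f: "f \<in> CF"
  shows "(\<integral>R. norm (zero_i1 (R *v e1)) ^ n \<partial>\<mu>) * Qf f (\<lambda>x. \<phi> (ip a x)) =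
    (\<integral>R. \<phi> ((R *v e1) $ i2) \<partial>\<mu>) * (\<integral>R. f (R *v e1) * norm (zero_i1 (adj R *v a)) ^ n \<partial>\<mu>)"
proof -
  interpret P: pair_sigma_finite \<mu> \<mu> ..
  interpret PP: prob_space "\<mu> \<Otimes>\<^sub>M \<mu>" by (intro prob_space_pair prob_space_\<mu>)
  have fc: "continuous_on UNIV f" using f by (simp add: CF_def)
  define g where "g = (\<lambda>x. \<phi> (ip a x))"
  have gc: "continuous_on UNIV g" unfolding g_def
    by (intro continuous_on_compose2[OF \<phi>(1)] continuous_intros) auto
  note [measurable] = measurable_continuous[OF fc] measurable_continuous[OF gc]
  obtain C where C: "C \<ge> 0" "\<And>x. norm x \<le> 1 \<Longrightarrow> \<bar>f x\<bar> \<le> C" using continuous_bounded[OF fc] by blast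
  obtain D where D: "D \<ge> 0" "\<And>x. norm x \<le> 1 \<Longrightarrow> \<bar>g x\<bar> \<le> D" using continuous_bounded[OF gc] by blast
  let ?h = "\<lambda>R' R. f (R *v e1) * g (R *v zero_i1 (R' *v e1))"
  have int: "integrable (\<mu> \<Otimes>\<^sub>M \<mu>) (case_prod ?h)"
  proof (rule PP.integrable_const_bound[where B = "C * D"])
    show "case_prod ?h \<in> borel_measurable (\<mu> \<Otimes>\<^sub>M \<mu>)" by measurable
    have "norm (zero_i1 (R' *v e1)) \<le> 1" if "R' \<in> ugroup" for R'
      using norm_zero_i1_le[of "R' *v e1"] that by (simp add: ugroup_norm)
    then have "\<bar>?h R' R\<bar> \<le> C * D" if "R \<in> ugroup" "R' \<in> ugroup" for R R'
      unfolding abs_mult using that C D by (intro mult_mono) (auto simp: ugroup_norm)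
    then show "AE x in \<mu> \<Otimes>\<^sub>M \<mu>. norm (case_prod ?h x) \<le> C * D"
      by (intro AE_I2) (auto simp: space_pair_measure space_\<mu>)
  qed
  \<comment> \<open>Integrating over \<open>R\<close> first: the projection of
    \<open>R' *v e1\<close> is \<open>r\<close> times a unit vector orthogonal to \<open>e1\<close>,
    which the pair law replaces by \<open>e2\<close>, and homogeneity extracts
    \<open>r ^ n\<close>.\<close>
  have "(\<integral>R. ?h R' R \<partial>\<mu>) = norm (zero_i1 (R' *v e1)) ^ n * Qf f g" for R'
  proof (cases "zero_i1 (R' *v e1) = 0")
    case True
    have "g 0 = 0" using \<phi>(2)[of 0 0] n by (simp add: g_def ip_def power_0_left)
    then show ?thesis using True n by (simp add: power_0_left)
  next
    case False
    define r \<eta> where "r = norm (zero_i1 (R' *v e1))" and "\<eta> = zero_i1 (R' *v e1) /\<^sub>R r"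
    have \<eta>: "zero_i1 (R' *v e1) = r *\<^sub>R \<eta>" "r \<ge> 0" using False by (auto simp: r_def \<eta>_def)
    have "onpair e1 \<eta>" using False
      by (simp add: onpair_def \<eta>_def r_def ip_scaleR_right zero_i1_orthogonal)
    then have "(\<integral>R. f (R *v e1) * g (R *v \<eta>) \<partial>\<mu>) = Qf f g"
      unfolding Qf_def by (intro integral_pair_law onpair_e) auto
    moreover have "g (R *v (r *\<^sub>R \<eta>)) = r ^ n * g (R *v \<eta>)" for R
      using \<phi>(2)[OF \<eta>(2)] by (simp add: g_def mult_scaleR ip_scaleR_right)
    ultimately show ?thesis unfolding \<eta>(1) using \<eta>(2) \<open>onpair e1 \<eta>\<close>
      by (simp add: mult.left_commute onpair_def)
  qed
  then have 1: "(\<integral>R'. \<integral>R. ?h R' R \<partial>\<mu> \<partial>\<mu>) = (\<integral>R. norm (zero_i1 (R *v e1)) ^ n \<partial>\<mu>) * Qf f g" by simp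
  have 2: "(\<integral>R'. \<integral>R. ?h R' R \<partial>\<mu> \<partial>\<mu>) = (\<integral>R. \<integral>R'. ?h R' R \<partial>\<mu> \<partial>\<mu>)"
    using P.Fubini_integral[OF int] by simp
  \<comment> \<open>Integrating over \<open>R'\<close> first: moving \<open>R\<close> and the
    projection to the other side leaves \<open>\<phi>\<close> of a linear functional of
    \<open>R' *v e1\<close>, so \<open>homogeneous_moment\<close> applies.\<close>
  have "(\<integral>R'. ?h R' R \<partial>\<mu>) =
      (\<integral>R. \<phi> ((R *v e1) $ i2) \<partial>\<mu>) * (f (R *v e1) * norm (zero_i1 (adj R *v a)) ^ n)" for R
  proof -
    have "g (R *v zero_i1 x) = \<phi> (ip (zero_i1 (adj R *v a)) x)" for x
      by (simp add: g_def ip_zero_i1[symmetric] ip_mult_left)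
    then show ?thesis using homogeneous_moment[OF \<phi> n, of "zero_i1 (adj R *v a)"] by simp
  qed
  then have "(\<integral>R. \<integral>R'. ?h R' R \<partial>\<mu> \<partial>\<mu>) =
      (\<integral>R. (\<integral>R. \<phi> ((R *v e1) $ i2) \<partial>\<mu>) * (f (R *v e1) * norm (zero_i1 (adj R *v a)) ^ n) \<partial>\<mu>)"
    by (simp only:)
  also have "\<dots> = (\<integral>R. \<phi> ((R *v e1) $ i2) \<partial>\<mu>) * (\<integral>R. f (R *v e1) * norm (zero_i1 (adj R *v a)) ^ n \<partial>\<mu>)"
    by (rule integral_mult_right_zero)
  finally show ?thesis using 1 2 by (simp only: g_def)
qed

text \<open>Pythagoras for \<open>adj R *v a\<close>, whose component along \<open>e1\<close> is
  \<open>ip (R *v e1) a\<close>. The right side depends on \<open>R\<close> only through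
  \<open>R *v e1\<close>, so it can enter the form \<open>B\<close>.\<close>

lemma norm_zero_i1_adj:
  assumes "R \<in> ugroup"
  shows "(norm (zero_i1 (adj R *v a)))\<^sup>2 = (norm a)\<^sup>2 - (norm (ip a (R *v e1)))\<^sup>2"
proof -
  have "(adj R *v a) $ i1 = ip (R *v e1) a" by (simp add: ip_mult_left ip_axis)
  then show ?thesis
    using ugroup_norm[OF ugroup_adj[OF assms]] by (simp add: norm_zero_i1 norm_ip_commute[of a])
qed

text \<open>For even degree the power of the norm in \<open>orthogonal_average\<close> becomes a
  polynomial in \<open>(norm (ip a x))\<^sup>2\<close>, which is what makes the averaging operator
  triangular on powers.\<close>

lemma orthogonal_average_even:
  fixes \<phi> :: "'a \<Rightarrow> real"
  assumes \<phi>: "continuous_on UNIV \<phi>" "\<And>r s. r \<ge> 0 \<Longrightarrow> \<phi> (r *\<^sub>R s) = r ^ (2 * p) * \<phi> s" and p: "p > 0"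
    and f: "f \<in> CF"
  shows "(\<integral>R. norm (zero_i1 (R *v e1)) ^ (2 * p) \<partial>\<mu>) * Qf f (\<lambda>x. \<phi> (ip a x)) =
    (\<integral>R. \<phi> ((R *v e1) $ i2) \<partial>\<mu>) * Bf f (\<lambda>x. ((norm a)\<^sup>2 - (norm (ip a x))\<^sup>2) ^ p)"
proof -
  have "(\<integral>R. f (R *v e1) * norm (zero_i1 (adj R *v a)) ^ (2 * p) \<partial>\<mu>) =
      Bf f (\<lambda>x. ((norm a)\<^sup>2 - (norm (ip a x))\<^sup>2) ^ p)"
    unfolding Bf_def by (intro Bochner_Integration.integral_cong) (auto simp: power_mult norm_zero_i1_adj space_\<mu>)
  then show ?thesis using orthogonal_average[OF \<phi> _ f, of a] p by simp
qed

text \<open>Even moments of a single coordinate, and of the length of the projection orthogonal to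
  \<open>e1\<close>. Their ratio is, up to sign, the diagonal entry belonging to
  \<open>norm (ip a x) ^ (2 * p)\<close>.\<close>

definition \<kappa> :: "nat \<Rightarrow> real" where "\<kappa> p = (\<integral>R. norm ((R *v e1) $ i2) ^ (2 * p) \<partial>\<mu>)"
definition \<sigma> :: "nat \<Rightarrow> real" where "\<sigma> p = (\<integral>R. norm (zero_i1 (R *v e1)) ^ (2 * p) \<partial>\<mu>)"

lemma integrable_coordinate:
  "integrable \<mu> (\<lambda>R. norm ((R *v e1) $ j) ^ k)"
proof -
  have "continuous_on UNIV (\<lambda>x :: 'a ^ 'n. norm (x $ j) ^ k)" by (intro continuous_intros)
  from integrable_pair[OF this continuous_on_const[of _ 1] norm_e(1) norm_e(1)] show ?thesis by simp
qed

lemma coordinate_moment: "(\<integral>R. norm ((R *v e1) $ j) ^ (2 * p) \<partial>\<mu>) = \<kappa> p"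
  using integral_functional_law[OF norm_axis_one norm_e(2), of "\<lambda>s. norm s ^ (2 * p)" j]
  by (simp add: \<kappa>_def ip_axis)

text \<open>All coordinates have the same moment \<open>\<kappa> p\<close>. Summing over those other
  than \<open>i1\<close> and comparing a sum of \<open>p\<close>-th powers with the
  \<open>p\<close>-th power of the sum yields the factor \<open>d - 1\<close>.\<close>

lemma \<kappa>_le_\<sigma>:
  assumes p: "p > 0" shows "(real CARD('n) - 1) * \<kappa> p \<le> \<sigma> p"
proof -
  have "continuous_on UNIV (\<lambda>x :: 'a ^ 'n. norm (zero_i1 x) ^ (2 * p))" by (intro continuous_intros)
  from integrable_pair[OF this continuous_on_const[of _ 1] norm_e(1) norm_e(1)]
  have int: "integrable \<mu> (\<lambda>R. norm (zero_i1 (R *v e1)) ^ (2 * p))" by simp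
  have "(real CARD('n) - 1) * \<kappa> p = (\<Sum>j\<in>UNIV - {i1}. (\<integral>R. norm ((R *v e1) $ j) ^ (2 * p) \<partial>\<mu>))"
    by (simp add: coordinate_moment card_Diff_singleton of_nat_diff)
  also have "\<dots> = (\<integral>R. (\<Sum>j\<in>UNIV - {i1}. norm ((R *v e1) $ j) ^ (2 * p)) \<partial>\<mu>)"
    by (rule Bochner_Integration.integral_sum[symmetric]) (rule integrable_coordinate)
  also have "\<dots> \<le> \<sigma> p" unfolding \<sigma>_def
  proof (rule integral_mono)
    show "integrable \<mu> (\<lambda>R. \<Sum>j\<in>UNIV - {i1}. norm ((R *v e1) $ j) ^ (2 * p))"
      by (intro Bochner_Integration.integrable_sum integrable_coordinate)
    show "(\<Sum>j\<in>UNIV - {i1}. norm ((R *v e1) $ j) ^ (2 * p)) \<le> norm (zero_i1 (R *v e1)) ^ (2 * p)" for R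
      unfolding power_mult norm_zero_i1_sum using p by (intro sum_power_le_power_sum) auto
  qed (rule int)
  finally show ?thesis .
qed

text \<open>A vanishing moment would make the coordinate zero almost surely and hence
  \<open>\<kappa> 1 = 0\<close>, but the second moments of all coordinates add up to 1.\<close>

lemma \<kappa>_pos: "p > 0 \<Longrightarrow> \<kappa> p > 0"
proof (rule ccontr)
  assume p: "p > 0" "\<not> \<kappa> p > 0"
  moreover have "\<kappa> p \<ge> 0" unfolding \<kappa>_def by (intro Bochner_Integration.integral_nonneg) auto
  ultimately have "\<kappa> p = 0" by linarith
  then have "(\<integral>R. norm ((R *v e1) $ i2) ^ (2 * p) \<partial>\<mu>) = 0" by (simp add: \<kappa>_def)
  then have "AE R in \<mu>. norm ((R *v e1) $ i2) ^ (2 * p) = 0"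
    by (subst (asm) integral_nonneg_eq_0_iff_AE) (auto intro!: integrable_coordinate)
  then have "AE R in \<mu>. norm ((R *v e1) $ i2) ^ (2 * 1) = 0" using p by simp
  then have z: "\<kappa> 1 = 0" unfolding \<kappa>_def by (intro integral_eq_zero_AE)
  have "real CARD('n) * \<kappa> 1 = (\<Sum>j\<in>UNIV. (\<integral>R. norm ((R *v e1) $ j) ^ (2 * 1) \<partial>\<mu>))"
    by (simp only: coordinate_moment) simp
  also have "\<dots> = (\<integral>R. (\<Sum>j\<in>UNIV. norm ((R *v e1) $ j) ^ (2 * 1)) \<partial>\<mu>)"
    by (rule Bochner_Integration.integral_sum[symmetric]) (rule integrable_coordinate)
  also have "\<dots> = (\<integral>R. 1 \<partial>\<mu>)"
    by (intro Bochner_Integration.integral_cong) (auto simp: norm_vec_sq[symmetric] ugroup_norm space_\<mu>)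
  finally show False using z by (simp add: \<mu>.prob_space)
qed

lemma card_ge_2: "real CARD('n) \<ge> 2"
  using card_mono[of UNIV "{i1, i2}"] i12 by simp

lemma \<sigma>_pos: "p > 0 \<Longrightarrow> \<sigma> p > 0"
  using \<kappa>_le_\<sigma>[of p] \<kappa>_pos[of p] card_ge_2 mult_pos_pos[of "real CARD('n) - 1" "\<kappa> p"] by linarith

lemma \<kappa>_\<sigma>_bound:
  assumes p: "p > 0" shows "(- 1) ^ p * (\<kappa> p / \<sigma> p) \<le> 1 / (real CARD('n) - 1)"
proof -
  have d: "real CARD('n) - 1 > 0" using card_ge_2 by simp
  have "(- 1) ^ p * (\<kappa> p / \<sigma> p) \<le> 1 * (\<kappa> p / \<sigma> p)"
    using \<kappa>_pos[OF p] \<sigma>_pos[OF p] by (intro mult_right_mono) (auto simp: minus_one_power_iff)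
  also have "\<dots> \<le> 1 / (real CARD('n) - 1)"
    using \<kappa>_le_\<sigma>[OF p] d \<sigma>_pos[OF p] by (simp add: divide_le_eq pos_le_divide_eq mult.commute)
  finally show ?thesis .
qed

section \<open>Flags containing the powers of an inner product\<close>

abbreviation ip_power :: "'a ^ 'n \<Rightarrow> nat \<Rightarrow> 'a ^ 'n \<Rightarrow> real" where
  "ip_power a k \<equiv> (\<lambda>x. norm (ip a x) ^ (2 * k))"

lemma ip_power_CF: "ip_power a k \<in> CF"
  unfolding CF_def by (auto intro!: continuous_intros)

text \<open>The top term of the binomial expansion is split off: its coefficient gives the sign of
  the diagonal entry, while the rest lies in the flag built so far.\<close>

lemma orthogonal_defect_expand:
  "((norm a)\<^sup>2 - (norm (ip a x))\<^sup>2) ^ p =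
    (\<Sum>k<p. (of_nat (p choose k) * (-1) ^ k * (norm a) ^ (2 * (p - k))) * ip_power a k x) + (-1) ^ p * ip_power a p x"
proof -
  have "((norm a)\<^sup>2 - (norm (ip a x))\<^sup>2) ^ p = (- (norm (ip a x))\<^sup>2 + (norm a)\<^sup>2) ^ p"
    by (simp add: algebra_simps)
  also have "\<dots> = (\<Sum>k\<le>p. (of_nat (p choose k) * (-1) ^ k * (norm a) ^ (2 * (p - k))) * ip_power a k x)"
    unfolding binomial_ring power_mult
    by (intro sum.cong) (simp_all add: power_minus[of "(norm (ip a x))\<^sup>2"] mult.assoc mult.left_commute mult.commute)
  finally show ?thesis by (simp add: lessThan_Suc_atMost[symmetric])
qed

text \<open>The powers are adjoined in increasing order;
  \<open>(-1) ^ p * (\<kappa> p / \<sigma> p)\<close> is the diagonal entry of the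
  \<open>p\<close>-th one. Starting from an arbitrary flag allows iteration over several vectors
  \<open>a\<close>.\<close>

lemma flag_ip_power:
  assumes "flag W"
  shows "\<exists>W'. flag W' \<and> W \<subseteq> W' \<and> (\<forall>k\<le>N. ip_power a k \<in> W')"
proof (induction N)
  case 0
  then show ?case using assms flag_contains_const[OF assms, of 1] by (intro exI[of _ W]) simp
next
  case (Suc q)
  then obtain V where V: "flag V" "W \<subseteq> V" "\<And>k. k \<le> q \<Longrightarrow> ip_power a k \<in> V" by blast
  define p where "p = Suc q"
  have p: "p > 0" by (simp add: p_def)
  define L where "L = (\<lambda>x. \<Sum>k<p. (of_nat (p choose k) * (-1) ^ k * (norm a) ^ (2 * (p - k))) * ip_power a k x)"
  have L: "L \<in> V" unfolding L_def using V(1,3) by (intro flag_sum) (auto simp: p_def)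
  then have LF: "L \<in> CF" using flag_subset[OF V(1)] by blast
  define r where "r = \<kappa> p / \<sigma> p"
  have "Qf f (ip_power a p) = ((-1) ^ p * r) * Bf f (ip_power a p) + Bf f (\<lambda>x. r * L x)" if f: "f \<in> CF" for f
  proof -
    have "\<sigma> p * Qf f (ip_power a p) = \<kappa> p * Bf f (\<lambda>x. ((norm a)\<^sup>2 - (norm (ip a x))\<^sup>2) ^ p)"
      unfolding \<kappa>_def \<sigma>_def
      by (rule orthogonal_average_even[OF _ _ p f, of "\<lambda>s. norm s ^ (2 * p)" a])
        (auto intro!: continuous_intros simp: power_mult_distrib)
    then have "Qf f (ip_power a p) = r * Bf f (\<lambda>x. L x + (-1) ^ p * ip_power a p x)"
      using \<sigma>_pos[OF p] by (simp add: r_def orthogonal_defect_expand L_def nonzero_eq_divide_eq mult.commute)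
    also have "Bf f (\<lambda>x. L x + (-1) ^ p * ip_power a p x) = Bf f L + (-1) ^ p * Bf f (ip_power a p)"
      by (rule B_lin_right[OF LF ip_power_CF f])
    finally show ?thesis using B_scale_right[OF f LF, of r] by (simp add: algebra_simps)
  qed
  then have "flag (adjoin V (ip_power a p))"
    using \<kappa>_\<sigma>_bound[OF p, folded r_def] by (intro flag_extend[OF V(1) ip_power_CF _ flag_scale[OF V(1) L, of r]])
  moreover have "W \<subseteq> adjoin V (ip_power a p)" using V(2) adjoin_mono by blast
  moreover have "ip_power a k \<in> adjoin V (ip_power a p)" if "k \<le> Suc q" for k
    using that V(3)[of k] flag_adjoin_new[OF V(1)] adjoin_mono by (cases "k = p") (auto simp: p_def)
  ultimately show ?case by blast
qed

text \<open>Both parities have diagonal entry 0. Averaging an even power gives a multiple of a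
  function that lies in the span of the \<open>ip_power a k\<close>, which are adjoined first; odd
  powers average to zero. Over the reals the even powers are adjoined a second time, which a flag
  permits.\<close>

lemma flag_inner_powers:
  assumes "flag W"
  shows "\<exists>W'. flag W' \<and> W \<subseteq> W' \<and> (\<forall>i\<le>N. (\<lambda>x. (a \<bullet> x) ^ i) \<in> W')"
proof -
  obtain V where V: "flag V" "W \<subseteq> V" "\<And>k. k \<le> N \<Longrightarrow> ip_power a k \<in> V" using flag_ip_power[OF assms] by blast
  have "\<exists>W'. flag W' \<and> V \<subseteq> W' \<and> (\<forall>i\<le>M. (\<lambda>x. (a \<bullet> x) ^ i) \<in> W')" if "M \<le> N" for M
    using that
  proof (induction M)
    case 0
    then show ?case using V flag_contains_const[OF V(1), of 1] by (intro exI[of _ V]) simp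
  next
    case (Suc M)
    then obtain U where U: "flag U" "V \<subseteq> U" "\<And>i. i \<le> M \<Longrightarrow> (\<lambda>x. (a \<bullet> x) ^ i) \<in> U" by auto
    define n where "n = Suc M"
    define g where "g = (\<lambda>x. (a \<bullet> x) ^ n)"
    have gF: "g \<in> CF" unfolding CF_def g_def by (auto intro!: continuous_intros)
    have "\<exists>k\<in>U. \<forall>f\<in>CF. Qf f g = 0 * Bf f g + Bf f k"
    proof (cases "even n")
      case True
      then obtain p where n2: "n = 2 * p" by (auto elim: evenE)
      have p: "p > 0" "p \<le> N" using n2 Suc.prems by (auto simp: n_def)
      define T where "T = (\<lambda>x. ((norm a)\<^sup>2 - (norm (ip a x))\<^sup>2) ^ p)"
      have T: "T \<in> U" unfolding T_def orthogonal_defect_expand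
        using p V(3) U(2) by (intro flag_add[OF U(1)] flag_sum[OF U(1)] flag_scale[OF U(1)]) auto
      have TF: "T \<in> CF" using T flag_subset[OF U(1)] by blast
      define r where "r = (\<integral>R. (1 \<bullet> ((R *v e1) $ i2)) ^ (2 * p) \<partial>\<mu>) / \<sigma> p"
      have "Qf f g = 0 * Bf f g + Bf f (\<lambda>x. r * T x)" if f: "f \<in> CF" for f
      proof -
        have "\<sigma> p * Qf f (\<lambda>x. (1 \<bullet> ip a x) ^ (2 * p)) =
            (\<integral>R. (1 \<bullet> ((R *v e1) $ i2)) ^ (2 * p) \<partial>\<mu>) * Bf f T"
          unfolding \<sigma>_def T_def
          by (rule orthogonal_average_even[OF _ _ p(1) f, of "\<lambda>s. (1 \<bullet> s) ^ (2 * p)" a])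
            (auto intro!: continuous_intros simp: power_mult_distrib)
        then have "Qf f g = r * Bf f T" using \<sigma>_pos[OF p(1)]
          by (simp add: r_def g_def inner_one_ip n2 nonzero_eq_divide_eq mult.commute)
        then show ?thesis using B_scale_right[OF f TF] by simp
      qed
      then show ?thesis using flag_scale[OF U(1) T] by blast
    next
      case False
      have "Qf f g = 0" if f: "f \<in> CF" for f
      proof -
        \<comment> \<open>Replacing \<open>e2\<close> by \<open>- e2\<close> preserves the pair law
          and changes the sign of an odd power.\<close>
        have "onpair e1 (- e2)" using onpair_e ip_scaleR_right[of e1 "-1" e2] by (simp add: onpair_def)
        then have "Qf f g = (\<integral>R. f (R *v e1) * g (R *v (- e2)) \<partial>\<mu>)" unfolding Qf_def
          using f gF by (intro integral_pair_law onpair_e measurable_continuous) (auto simp: CF_def)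
        also have "\<dots> = (\<integral>R. - (f (R *v e1) * g (R *v e2)) \<partial>\<mu>)"
        proof -
          have "R *v (- e2) = - (R *v e2)" for R :: "'a ^ 'n ^ 'n" using mult_scaleR[of R "-1" e2] by simp
          then have "g (R *v (- e2)) = - g (R *v e2)" for R using False by (simp add: g_def)
          then show ?thesis by (simp only: mult_minus_right)
        qed
        also have "\<dots> = - Qf f g" by (simp add: Qf_def)
        finally show ?thesis by simp
      qed
      then show ?thesis using flag_contains_const[OF U(1), of 0]
        by (intro bexI[of _ "\<lambda>_. 0"]) (auto simp: Bf_def)
    qed
    then obtain k where k: "k \<in> U" "\<And>f. f \<in> CF \<Longrightarrow> Qf f g = 0 * Bf f g + Bf f k" by blast
    have "flag (adjoin U g)"
      using card_ge_2 by (intro flag_extend[OF U(1) gF _ k(1) k(2)]) auto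
    moreover have "V \<subseteq> adjoin U g" using U(2) adjoin_mono by blast
    moreover have "(\<lambda>x. (a \<bullet> x) ^ i) \<in> adjoin U g" if "i \<le> Suc M" for i
    proof (cases "i = n")
      case True
      then show ?thesis using flag_adjoin_new[OF U(1), of g] by (simp add: g_def)
    next
      case False
      then show ?thesis using that adjoin_mono[OF U(3)] by (simp add: n_def)
    qed
    ultimately show ?case by blast
  qed
  from this[of N] show ?thesis using V(2) by blast
qed

lemma flag_inner_powers_finite:
  assumes "finite S"
  shows "\<exists>W. flag W \<and> (\<forall>a\<in>S. \<forall>i\<le>N. (\<lambda>x. (a \<bullet> x) ^ i) \<in> W)"
  using assms
proof (induction S rule: finite_induct)
  case empty
  then show ?case using flag_const by blast
next
  case (insert a S)
  then obtain W where W: "flag W" "\<forall>a\<in>S. \<forall>i\<le>N. (\<lambda>x. (a \<bullet> x) ^ i) \<in> W" by blast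
  obtain W' where "flag W'" "W \<subseteq> W'" "\<forall>i\<le>N. (\<lambda>x. (a \<bullet> x) ^ i) \<in> W'"
    using flag_inner_powers[OF W(1)] by blast
  then show ?case using W(2) by (intro exI[of _ W']) blast
qed

section \<open>Density of the flags among continuous functions on the sphere\<close>

inductive_set expspan :: "('a ^ 'n \<Rightarrow> real) set" where
  expspan_exp: "(\<lambda>x. c * exp (a \<bullet> x)) \<in> expspan"
| expspan_add: "f \<in> expspan \<Longrightarrow> g \<in> expspan \<Longrightarrow> (\<lambda>x. f x + g x) \<in> expspan"

text \<open>This is the reason for using exponentials: a product of two of them is again one,
  whereas a product of powers of two different functionals would call for polarization.\<close>

lemma expspan_mult: "f \<in> expspan \<Longrightarrow> g \<in> expspan \<Longrightarrow> (\<lambda>x. f x * g x) \<in> expspan"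
proof (induction rule: expspan.induct)
  case (expspan_exp c a)
  from \<open>g \<in> expspan\<close> show ?case
  proof (induction rule: expspan.induct)
    case (expspan_exp c' a')
    have "(\<lambda>x. c * exp (a \<bullet> x) * (c' * exp (a' \<bullet> x))) = (\<lambda>x. (c * c') * exp ((a + a') \<bullet> x))"
      by (auto simp: inner_add_left exp_add)
    then show ?case using expspan.expspan_exp by simp
  next
    case (expspan_add f g)
    then show ?case using expspan.expspan_add by (simp add: distrib_left)
  qed
next
  case (expspan_add f h)
  then show ?case using expspan.expspan_add by (simp add: distrib_right)
qed

lemma expspan_continuous: "f \<in> expspan \<Longrightarrow> continuous_on S f"
  by (induction rule: expspan.induct) (auto intro!: continuous_intros)

text \<open>The Lagrange remainder is at most \<open>exp b\<close> times a term of the convergent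
  exponential series at \<open>b\<close>.\<close>

lemma exp_truncation_uniform:
  fixes b \<eta> :: real
  assumes "\<eta> > 0"
  shows "\<exists>N. \<forall>t. \<bar>t\<bar> \<le> b \<longrightarrow> \<bar>exp t - (\<Sum>i<N. t ^ i / fact i)\<bar> < \<eta>"
proof -
  have "(\<lambda>n. exp b * (inverse (fact n) * b ^ n)) \<longlonglongrightarrow> exp b * 0"
    by (intro tendsto_intros summable_LIMSEQ_zero summable_exp)
  then have "eventually (\<lambda>n. exp b * (inverse (fact n) * b ^ n) < \<eta>) sequentially"
    using assms by (intro order_tendstoD) auto
  then obtain N where N: "exp b * (inverse (fact N) * b ^ N) < \<eta>" by (auto simp: eventually_sequentially)
  have "\<bar>exp t - (\<Sum>i<N. t ^ i / fact i)\<bar> < \<eta>" if t: "\<bar>t\<bar> \<le> b" for t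
  proof -
    obtain s where s: "\<bar>s\<bar> \<le> \<bar>t\<bar>" "exp t = (\<Sum>m<N. (t ^ m) / fact m) + (exp s / fact N) * t ^ N"
      using Maclaurin_exp_le by blast
    have "\<bar>exp t - (\<Sum>i<N. t ^ i / fact i)\<bar> = exp s * (inverse (fact N) * \<bar>t\<bar> ^ N)"
      unfolding s(2) by (simp add: abs_mult power_abs field_simps)
    also have "\<dots> \<le> exp b * (inverse (fact N) * b ^ N)"
      using s(1) t by (intro mult_mono power_mono) auto
    finally show ?thesis using N by simp
  qed
  then show ?thesis by blast
qed

text \<open>The approximant is found in any flag that contains enough powers. In this form two
  summands can share one flag: take the union of the vector sets and the larger of the two
  degrees.\<close>

lemma expspan_approx:
  "f \<in> expspan \<Longrightarrow> \<exists>S. finite S \<and> (\<forall>\<eta>>0. \<exists>N. \<forall>W. flag W \<and> (\<forall>a\<in>S. \<forall>i\<le>N. (\<lambda>x. (a \<bullet> x) ^ i) \<in> W) \<longrightarrow>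
    (\<exists>p\<in>W. \<forall>x\<in>sphere 0 1. \<bar>f x - p x\<bar> < \<eta>))"
proof (induction rule: expspan.induct)
  case (expspan_exp c a)
  show ?case
  proof (intro exI[of _ "{a}"] conjI allI impI)
    fix \<eta> :: real assume "\<eta> > 0"
    \<comment> \<open>Adding 1 covers \<open>c = 0\<close> and keeps the final inequality
      strict.\<close>
    then have "\<eta> / (\<bar>c\<bar> + 1) > 0" by simp
    then obtain N where N: "\<And>t. \<bar>t\<bar> \<le> norm a \<Longrightarrow> \<bar>exp t - (\<Sum>i<N. t ^ i / fact i)\<bar> < \<eta> / (\<bar>c\<bar> + 1)"
      using exp_truncation_uniform by blast
    show "\<exists>N. \<forall>W. flag W \<and> (\<forall>a\<in>{a}. \<forall>i\<le>N. (\<lambda>x. (a \<bullet> x) ^ i) \<in> W) \<longrightarrow>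
        (\<exists>p\<in>W. \<forall>x\<in>sphere 0 1. \<bar>c * exp (a \<bullet> x) - p x\<bar> < \<eta>)"
    proof (intro exI[of _ N] allI impI)
      fix W assume W: "flag W \<and> (\<forall>a\<in>{a}. \<forall>i\<le>N. (\<lambda>x. (a \<bullet> x) ^ i) \<in> W)"
      define p where "p = (\<lambda>x. \<Sum>i<N. (c / fact i) * (a \<bullet> x) ^ i)"
      have "p \<in> W" unfolding p_def using W by (intro flag_sum) auto
      moreover have "\<bar>c * exp (a \<bullet> x) - p x\<bar> < \<eta>" if "x \<in> sphere 0 1" for x
      proof -
        have "\<bar>a \<bullet> x\<bar> \<le> norm a" using Cauchy_Schwarz_ineq2[of a x] that by simp
        then have *: "\<bar>exp (a \<bullet> x) - (\<Sum>i<N. (a \<bullet> x) ^ i / fact i)\<bar> < \<eta> / (\<bar>c\<bar> + 1)" by (rule N)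
        have "c * exp (a \<bullet> x) - p x = c * (exp (a \<bullet> x) - (\<Sum>i<N. (a \<bullet> x) ^ i / fact i))"
          by (simp add: p_def right_diff_distrib sum_distrib_left)
        then have "\<bar>c * exp (a \<bullet> x) - p x\<bar> = \<bar>c\<bar> * \<bar>exp (a \<bullet> x) - (\<Sum>i<N. (a \<bullet> x) ^ i / fact i)\<bar>"
          by (simp add: abs_mult)
        also have "\<dots> \<le> \<bar>c\<bar> * (\<eta> / (\<bar>c\<bar> + 1))" using * by (intro mult_left_mono) auto
        also have "\<dots> < \<eta>" using \<open>\<eta> > 0\<close> by (simp add: divide_less_eq mult.commute)
        finally show ?thesis .
      qed
      ultimately show "\<exists>p\<in>W. \<forall>x\<in>sphere 0 1. \<bar>c * exp (a \<bullet> x) - p x\<bar> < \<eta>" by blast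
    qed
  qed simp
next
  case (expspan_add f g)
  then obtain S T where S: "finite S" "\<And>\<eta>. \<eta> > 0 \<Longrightarrow> \<exists>N. \<forall>W. flag W \<and> (\<forall>a\<in>S. \<forall>i\<le>N. (\<lambda>x. (a \<bullet> x) ^ i) \<in> W) \<longrightarrow>
      (\<exists>p\<in>W. \<forall>x\<in>sphere 0 1. \<bar>f x - p x\<bar> < \<eta>)"
    and T: "finite T" "\<And>\<eta>. \<eta> > 0 \<Longrightarrow> \<exists>N. \<forall>W. flag W \<and> (\<forall>a\<in>T. \<forall>i\<le>N. (\<lambda>x. (a \<bullet> x) ^ i) \<in> W) \<longrightarrow>
      (\<exists>p\<in>W. \<forall>x\<in>sphere 0 1. \<bar>g x - p x\<bar> < \<eta>)" by blast
  show ?case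
  proof (intro exI[of _ "S \<union> T"] conjI allI impI)
    fix \<eta> :: real assume "\<eta> > 0"
    then have h: "\<eta> / 2 > 0" by simp
    obtain N where N: "\<And>W. flag W \<Longrightarrow> (\<forall>a\<in>S. \<forall>i\<le>N. (\<lambda>x. (a \<bullet> x) ^ i) \<in> W) \<Longrightarrow>
      (\<exists>p\<in>W. \<forall>x\<in>sphere 0 1. \<bar>f x - p x\<bar> < \<eta> / 2)" using S(2)[OF h] by blast
    obtain M where M: "\<And>W. flag W \<Longrightarrow> (\<forall>a\<in>T. \<forall>i\<le>M. (\<lambda>x. (a \<bullet> x) ^ i) \<in> W) \<Longrightarrow>
      (\<exists>p\<in>W. \<forall>x\<in>sphere 0 1. \<bar>g x - p x\<bar> < \<eta> / 2)" using T(2)[OF h] by blast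
    show "\<exists>N. \<forall>W. flag W \<and> (\<forall>a\<in>S \<union> T. \<forall>i\<le>N. (\<lambda>x. (a \<bullet> x) ^ i) \<in> W) \<longrightarrow>
      (\<exists>p\<in>W. \<forall>x\<in>sphere 0 1. \<bar>f x + g x - p x\<bar> < \<eta>)"
    proof (intro exI[of _ "max N M"] allI impI)
      fix W assume W: "flag W \<and> (\<forall>a\<in>S \<union> T. \<forall>i\<le>max N M. (\<lambda>x. (a \<bullet> x) ^ i) \<in> W)"
      obtain p where p: "p \<in> W" "\<forall>x\<in>sphere 0 1. \<bar>f x - p x\<bar> < \<eta> / 2" using N[of W] W by auto
      obtain q where q: "q \<in> W" "\<forall>x\<in>sphere 0 1. \<bar>g x - q x\<bar> < \<eta> / 2" using M[of W] W by auto
      have "\<bar>f x + g x - (p x + q x)\<bar> < \<eta>" if "x \<in> sphere 0 1" for x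
        using p(2)[rule_format, OF that] q(2)[rule_format, OF that] by linarith
      then show "\<exists>p\<in>W. \<forall>x\<in>sphere 0 1. \<bar>f x + g x - p x\<bar> < \<eta>"
        using flag_add[of W p q] W p q by (intro bexI[of _ "\<lambda>x. p x + q x"]) auto
    qed
  qed (use S T in auto)
qed

lemma flags_dense:
  fixes f :: "'a ^ 'n \<Rightarrow> real"
  assumes f: "continuous_on UNIV f" and \<eta>: "\<eta> > 0"
  shows "\<exists>W p. flag W \<and> p \<in> W \<and> (\<forall>x\<in>sphere 0 1. \<bar>f x - p x\<bar> < \<eta>)"
proof -
  have ring: "function_ring_on expspan (sphere 0 1)"
  proof
    show "compact (sphere 0 1 :: ('a ^ 'n) set)" by simp
    show "(\<lambda>_. c) \<in> expspan" for c using expspan_exp[of c 0] by simp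
    show "\<exists>f\<in>expspan. f x \<noteq> f y" if "x \<noteq> y" for x y
    proof -
      have "(x - y) \<bullet> x - (x - y) \<bullet> y = (x - y) \<bullet> (x - y)" by (rule inner_diff_right[symmetric])
      then have "(x - y) \<bullet> x \<noteq> (x - y) \<bullet> y" using that by auto
      then show ?thesis
        by (intro bexI[of _ "\<lambda>z. 1 * exp ((x - y) \<bullet> z)"] expspan_exp) simp
    qed
  qed (auto intro: expspan_continuous expspan_add expspan_mult)
  have "continuous_on (sphere 0 1) f" using f continuous_on_subset by blast
  from function_ring_on.Stone_Weierstrass_basic[OF ring this, of "\<eta> / 2"] \<eta>
  obtain g where g: "g \<in> expspan" "\<forall>x\<in>sphere 0 1. \<bar>f x - g x\<bar> < \<eta> / 2" by auto
  obtain S N where S: "finite S" "\<And>W. flag W \<Longrightarrow> (\<forall>a\<in>S. \<forall>i\<le>N. (\<lambda>x. (a \<bullet> x) ^ i) \<in> W) \<Longrightarrow>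
      (\<exists>p\<in>W. \<forall>x\<in>sphere 0 1. \<bar>g x - p x\<bar> < \<eta> / 2)"
    using expspan_approx[OF g(1)] \<eta> half_gt_zero[OF \<eta>] by meson
  obtain W where W: "flag W" "\<forall>a\<in>S. \<forall>i\<le>N. (\<lambda>x. (a \<bullet> x) ^ i) \<in> W"
    using flag_inner_powers_finite[OF S(1)] by blast
  obtain p where p: "p \<in> W" "\<forall>x\<in>sphere 0 1. \<bar>g x - p x\<bar> < \<eta> / 2" using S(2)[OF W] by blast
  have "\<bar>f x - p x\<bar> < \<eta>" if "x \<in> sphere 0 1" for x
    using p(2)[rule_format, OF that] g(2)[rule_format, OF that] by linarith
  then show ?thesis using W p by blast
qed

section \<open>From flags to indicator functions\<close>

lemma integral_product_approx:
  fixes f p :: "'a ^ 'n \<Rightarrow> real"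
  assumes [measurable]: "f \<in> borel_measurable borel" "p \<in> borel_measurable borel"
    and f: "\<And>x. norm x = 1 \<Longrightarrow> \<bar>f x\<bar> \<le> 1" and p: "\<And>x. norm x = 1 \<Longrightarrow> \<bar>p x\<bar> \<le> 2"
    and xy: "norm x = 1" "norm y = 1"
    and \<eta>: "(\<integral>R. \<bar>f (R *v e1) - p (R *v e1)\<bar> \<partial>\<mu>) \<le> \<eta>"
  shows "\<bar>(\<integral>R. f (R *v x) * f (R *v y) \<partial>\<mu>) - (\<integral>R. p (R *v x) * p (R *v y) \<partial>\<mu>)\<bar> \<le> 3 * \<eta>"
proof -
  have law: "(\<integral>R. \<bar>f (R *v z) - p (R *v z)\<bar> \<partial>\<mu>) \<le> \<eta>" if "norm z = 1" for z
    using integral_single_law[OF that norm_e(1), of "\<lambda>x. \<bar>f x - p x\<bar>"] \<eta> by simp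
  have b: "\<bar>f (R *v z)\<bar> \<le> 1" "\<bar>p (R *v z)\<bar> \<le> 2" if "R \<in> ugroup" "norm z = 1" for R z
    using f p that by (auto simp: ugroup_norm)
  have int: "integrable \<mu> (\<lambda>R. \<bar>f (R *v z) - p (R *v z)\<bar>)" if "norm z = 1" for z
  proof (rule integrable_orbit[where C = 3])
    show "\<bar>\<bar>f (R *v z) - p (R *v z)\<bar>\<bar> \<le> 3" if "R \<in> ugroup" for R
      using b[OF that \<open>norm z = 1\<close>] by linarith
  qed measurable
  have i1: "integrable \<mu> (\<lambda>R. f (R *v x) * f (R *v y))"
  proof (rule integrable_orbit[where C = "1 * 1"])
    show "\<bar>f (R *v x) * f (R *v y)\<bar> \<le> 1 * 1" if "R \<in> ugroup" for R
      unfolding abs_mult by (rule mult_mono) (use b that xy in auto)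
  qed measurable
  have i2: "integrable \<mu> (\<lambda>R. p (R *v x) * p (R *v y))"
  proof (rule integrable_orbit[where C = "2 * 2"])
    show "\<bar>p (R *v x) * p (R *v y)\<bar> \<le> 2 * 2" if "R \<in> ugroup" for R
      unfolding abs_mult by (rule mult_mono) (use b that xy in auto)
  qed measurable
  have "\<bar>(\<integral>R. f (R *v x) * f (R *v y) \<partial>\<mu>) - (\<integral>R. p (R *v x) * p (R *v y) \<partial>\<mu>)\<bar> =
      \<bar>\<integral>R. f (R *v x) * f (R *v y) - p (R *v x) * p (R *v y) \<partial>\<mu>\<bar>"
    using i1 i2 by simp
  also have "\<dots> \<le> (\<integral>R. \<bar>f (R *v x) * f (R *v y) - p (R *v x) * p (R *v y)\<bar> \<partial>\<mu>)"
    by (rule integral_abs_bound)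
  also have "\<dots> \<le> (\<integral>R. \<bar>f (R *v y) - p (R *v y)\<bar> + 2 * \<bar>f (R *v x) - p (R *v x)\<bar> \<partial>\<mu>)"
  proof (rule integral_mono)
    show "integrable \<mu> (\<lambda>R. \<bar>f (R *v x) * f (R *v y) - p (R *v x) * p (R *v y)\<bar>)" using i1 i2 by simp
    show "integrable \<mu> (\<lambda>R. \<bar>f (R *v y) - p (R *v y)\<bar> + 2 * \<bar>f (R *v x) - p (R *v x)\<bar>)"
      using int xy by simp
    fix R assume "R \<in> space \<mu>"
    then have R: "R \<in> ugroup" by (simp add: space_\<mu>)
    \<comment> \<open>One factor is exchanged at a time; the bounds 1 for \<open>f\<close> and 2 for
      \<open>p\<close> add up to the constant 3.\<close>
    have "f (R *v x) * f (R *v y) - p (R *v x) * p (R *v y) =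
       f (R *v x) * (f (R *v y) - p (R *v y)) + p (R *v y) * (f (R *v x) - p (R *v x))"
      by (simp add: algebra_simps)
    also have "\<bar>\<dots>\<bar> \<le> \<bar>f (R *v x) * (f (R *v y) - p (R *v y))\<bar> + \<bar>p (R *v y) * (f (R *v x) - p (R *v x))\<bar>"
      by (rule abs_triangle_ineq)
    also have "\<dots> \<le> 1 * \<bar>f (R *v y) - p (R *v y)\<bar> + 2 * \<bar>f (R *v x) - p (R *v x)\<bar>"
      unfolding abs_mult using b[OF R] xy by (intro add_mono mult_right_mono) auto
    finally show "\<bar>f (R *v x) * f (R *v y) - p (R *v x) * p (R *v y)\<bar> \<le>
      \<bar>f (R *v y) - p (R *v y)\<bar> + 2 * \<bar>f (R *v x) - p (R *v x)\<bar>" by simp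
  qed
  also have "\<dots> \<le> 3 * \<eta>" using law[OF xy(1)] law[OF xy(2)] int xy by simp
  finally show ?thesis .
qed

text \<open>The indicator is replaced by a continuous function close to it in mean, and that one by
  a uniformly close element \<open>p\<close> of a flag. All functions stay bounded, so the variance
  bound for \<open>p\<close> passes to the indicator with arbitrarily small error.\<close>

lemma orthogonal_correlation_bound:
  assumes A[measurable]: "A \<in> sets borel"
  defines "u \<equiv> \<integral>R. indicator A (R *v e1) \<partial>\<mu>"
  shows "(real CARD('n) - 1) * ((\<integral>R. indicator A (R *v e1) * indicator A (R *v e2) \<partial>\<mu>) - u\<^sup>2) \<le> u - u\<^sup>2"
proof -
  let ?h = "indicator A :: 'a ^ 'n \<Rightarrow> real"
  define l where "l = 1 / (real CARD('n) - 1)"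
  have l: "0 \<le> l" "l \<le> 1" using card_ge_2 by (auto simp: l_def)
  have BB: "Bf ?h ?h = u" unfolding Bf_def u_def
    by (intro Bochner_Integration.integral_cong) (auto simp: indicator_def)
  have "Qf ?h ?h - u\<^sup>2 \<le> l * (u - u\<^sup>2)"
  proof (rule field_le_epsilon)
    fix e :: real assume "e > 0"
    \<comment> \<open>The errors below total \<open>12 * \<eta>\<close>: 3 from \<open>Q\<close>, 3
      from the squared mean, 6 from the right side. The cap at 1 serves the bounds
      \<open>\<bar>p x\<bar> \<le> 2\<close> and \<open>\<bar>u + v\<bar> \<le> 3\<close>.\<close>
    define \<eta> where "\<eta> = min 1 (e / 20)"
    have \<eta>: "0 < \<eta>" "\<eta> \<le> 1" "20 * \<eta> \<le> e" using \<open>e > 0\<close> by (auto simp: \<eta>_def)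
    define M where "M = distr \<mu> borel (\<lambda>R. R *v e1)"
    have M: "prob_space M" "sets M = sets borel" unfolding M_def
      by (auto intro!: \<mu>.prob_space_distr)
    obtain g where g: "continuous_on UNIV g" "\<And>x. 0 \<le> g x" "\<And>x. g x \<le> (1::real)"
        "(\<integral>x. \<bar>indicator A x - g x\<bar> \<partial>M) \<le> \<eta> / 2"
      using borel_indicator_approx[OF M A, of "\<eta> / 2"] \<eta> by auto
    obtain W p where W: "flag W" "p \<in> W" "\<And>x. norm x = 1 \<Longrightarrow> \<bar>g x - p x\<bar> < \<eta> / 2"
      using flags_dense[OF g(1), of "\<eta> / 2"] \<eta> by auto
    have pF: "p \<in> CF" using W flag_subset by blast
    have pc: "continuous_on UNIV p" using pF by (simp add: CF_def)
    note [measurable] = measurable_continuous[OF pc] measurable_continuous[OF g(1)]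
    have pb: "\<bar>p x\<bar> \<le> 2" if "norm x = 1" for x
      using W(3)[OF that] g(2,3)[of x] \<eta> by linarith
    have int1: "integrable \<mu> (\<lambda>R. \<bar>?h (R *v e1) - g (R *v e1)\<bar>)"
      using g(2,3) by (intro integrable_orbit[where C = 1]) (auto simp: indicator_def)
    have "(\<integral>R. \<bar>?h (R *v e1) - p (R *v e1)\<bar> \<partial>\<mu>) \<le> (\<integral>R. \<bar>?h (R *v e1) - g (R *v e1)\<bar> + \<eta> / 2 \<partial>\<mu>)"
    proof (rule integral_mono)
      show "integrable \<mu> (\<lambda>R. \<bar>?h (R *v e1) - p (R *v e1)\<bar>)"
      proof (rule integrable_orbit[where C = 3])
        show "\<bar>\<bar>?h (R *v e1) - p (R *v e1)\<bar>\<bar> \<le> 3" if "R \<in> ugroup" for R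
          using pb[of "R *v e1"] that by (auto simp: indicator_def ugroup_norm)
      qed measurable
      show "integrable \<mu> (\<lambda>R. \<bar>?h (R *v e1) - g (R *v e1)\<bar> + \<eta> / 2)" using int1 by simp
      fix R assume "R \<in> space \<mu>"
      then have "\<bar>g (R *v e1) - p (R *v e1)\<bar> < \<eta> / 2" by (intro W(3)) (simp add: space_\<mu> ugroup_norm)
      then show "\<bar>?h (R *v e1) - p (R *v e1)\<bar> \<le> \<bar>?h (R *v e1) - g (R *v e1)\<bar> + \<eta> / 2" by linarith
    qed
    also have "\<dots> = (\<integral>x. \<bar>?h x - g x\<bar> \<partial>M) + \<eta> / 2"
      using int1 by (simp add: M_def integral_distr \<mu>.prob_space)
    finally have close: "(\<integral>R. \<bar>?h (R *v e1) - p (R *v e1)\<bar> \<partial>\<mu>) \<le> \<eta>" using g(4) by simp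
    have hb: "\<bar>?h x\<bar> \<le> 1" for x by (simp add: indicator_def)
    have Q: "\<bar>Qf ?h ?h - Qf p p\<bar> \<le> 3 * \<eta>" unfolding Qf_def
      using hb pb close by (intro integral_product_approx) auto
    have B: "\<bar>Bf ?h ?h - Bf p p\<bar> \<le> 3 * \<eta>" unfolding Bf_def
      using hb pb close by (intro integral_product_approx) auto
    define v where "v = Bf p (\<lambda>_. 1)"
    have ih: "integrable \<mu> (\<lambda>R. ?h (R *v e1))"
      by (intro integrable_orbit[where C = 1]) (auto simp: indicator_def)
    have ip: "integrable \<mu> (\<lambda>R. p (R *v e1))"
      using integrable_pair[OF pc continuous_on_const[of _ 1] norm_e(1) norm_e(1)] by simp
    have "\<bar>u - v\<bar> = \<bar>\<integral>R. ?h (R *v e1) - p (R *v e1) \<partial>\<mu>\<bar>"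
      using ih ip by (simp add: u_def v_def Bf_def)
    also have "\<dots> \<le> (\<integral>R. \<bar>?h (R *v e1) - p (R *v e1)\<bar> \<partial>\<mu>)" by (rule integral_abs_bound)
    finally have uv: "\<bar>u - v\<bar> \<le> \<eta>" using close by simp
    have u01: "0 \<le> u" "u \<le> 1"
    proof -
      show "0 \<le> u" unfolding u_def by (intro Bochner_Integration.integral_nonneg) auto
      have "u \<le> (\<integral>R. 1 \<partial>\<mu>)" unfolding u_def using ih by (intro integral_mono) (auto simp: indicator_def)
      then show "u \<le> 1" by (simp add: \<mu>.prob_space)
    qed
    have sq: "\<bar>u\<^sup>2 - v\<^sup>2\<bar> \<le> 3 * \<eta>"
    proof -
      have "\<bar>u\<^sup>2 - v\<^sup>2\<bar> = \<bar>u - v\<bar> * \<bar>u + v\<bar>"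
        by (simp add: abs_mult[symmetric] power2_eq_square algebra_simps)
      also have "\<dots> \<le> \<eta> * 3" using uv u01 \<eta> by (intro mult_mono) auto
      finally show ?thesis by simp
    qed
    have main: "Qf p p - v\<^sup>2 \<le> l * (Bf p p - v\<^sup>2)"
      using flag_variance_bound[OF W(1,2)] by (simp add: v_def l_def)
    have "Bf p p - v\<^sup>2 \<le> (u - u\<^sup>2) + 6 * \<eta>" using B sq unfolding BB by linarith
    then have "l * (Bf p p - v\<^sup>2) \<le> l * ((u - u\<^sup>2) + 6 * \<eta>)" using l by (intro mult_left_mono)
    also have "\<dots> \<le> l * (u - u\<^sup>2) + 1 * (6 * \<eta>)"
      unfolding distrib_left using l \<eta> by (intro add_left_mono mult_right_mono) auto
    finally show "Qf ?h ?h - u\<^sup>2 \<le> l * (u - u\<^sup>2) + e" using main Q sq \<eta> by linarith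
  qed
  then have "(real CARD('n) - 1) * (Qf ?h ?h - u\<^sup>2) \<le> (real CARD('n) - 1) * (l * (u - u\<^sup>2))"
    using card_ge_2 by (intro mult_left_mono) auto
  also have "\<dots> = u - u\<^sup>2" using card_ge_2 by (simp add: l_def)
  finally show ?thesis by (simp add: Qf_def)
qed

end

section \<open>Counting basis vectors\<close>

context haar_action
begin

text \<open>Spanning is replaced by the cardinality, the form in which the counting argument uses
  it; \<open>onbs_onbasis\<close> supplies the link.\<close>

definition onbasis :: "('a ^ 'n) set \<Rightarrow> bool" where
  "onbasis B \<longleftrightarrow> finite B \<and> card B = CARD('n) \<and> (\<forall>b\<in>B. \<forall>c\<in>B. ip b c = (if b = c then 1 else 0))"

lemma onbasis_norm: "onbasis B \<Longrightarrow> b \<in> B \<Longrightarrow> norm b = 1"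
proof -
  assume "onbasis B" "b \<in> B"
  then have "of_real ((norm b)\<^sup>2) = (of_real 1 :: 'a)" using ip_self[of b] by (auto simp: onbasis_def)
  then have "(norm b)\<^sup>2 = 1" by (simp only: of_real_eq_iff)
  then show "norm b = 1" by (simp add: power2_eq_1_iff) (metis norm_ge_zero not_one_le_zero neg_0_le_iff_le)
qed

lemma onbasis_onpair: "onbasis B \<Longrightarrow> b \<in> B \<Longrightarrow> c \<in> B \<Longrightarrow> b \<noteq> c \<Longrightarrow> onpair b c"
  using onbasis_norm by (auto simp: onpair_def onbasis_def)

lemma card_image_Int:
  assumes B: "onbasis B" and R: "R \<in> ugroup"
  shows "real (card ((\<lambda>b. R *v b) ` B \<inter> A)) = (\<Sum>b\<in>B. indicator A (R *v b))"
proof -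
  have inj: "inj_on (\<lambda>b. R *v b) B"
    using ugroup_adj_cancel(1)[OF R] by (metis inj_onI)
  have "(\<lambda>b. R *v b) ` B \<inter> A = (\<lambda>b. R *v b) ` {b \<in> B. R *v b \<in> A}" by auto
  then have "card ((\<lambda>b. R *v b) ` B \<inter> A) = card {b \<in> B. R *v b \<in> A}"
    using inj by (simp add: card_image inj_on_subset)
  also have "real \<dots> = (\<Sum>b\<in>B. indicator A (R *v b))"
    using B by (simp add: onbasis_def indicator_def sum.If_cases Int_def)
  finally show ?thesis .
qed

text \<open>Chebyshev for the count \<open>N\<close>, a sum of indicators with common mean
  \<open>u\<close> and, for distinct basis vectors, common mixed moment \<open>q\<close>. The
  correlation bound keeps the variance of \<open>N\<close> below \<open>n\<close>, as if the
  indicators were nearly uncorrelated.\<close>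

lemma basis_count_tail:
  assumes B: "onbasis B" and A[measurable]: "A \<in> sets borel" and d: "CARD('n) \<ge> 2" and \<delta>: "\<delta> > 0" and x: "norm x = 1"
  defines "u \<equiv> measure \<mu> {R \<in> space \<mu>. R *v x \<in> A}"
  shows "measure \<mu> {R \<in> space \<mu>. \<delta> < \<bar>real (card ((\<lambda>b. R *v b) ` B \<inter> A)) / real CARD('n) - u\<bar>}
    \<le> 1 / (real CARD('n) * \<delta>\<^sup>2)"
proof -
  interpret \<mu>: prob_space \<mu> by (rule prob_space_\<mu>)
  obtain i1 i2 :: 'n where "i1 \<noteq> i2"
    using d by (metis card_1_singleton_iff card_le_Suc0_iff_eq finite iso_tuple_UNIV_I not_less_eq_eq numeral_2_eq_2)
  then interpret hp: haar_pair cj \<mu> i1 i2 by unfold_locales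
  define n where "n = real CARD('n)"
  have n: "n \<ge> 2" using d by (simp add: n_def)
  have fin: "finite B" "card B = CARD('n)" using B by (auto simp: onbasis_def)
  let ?h = "\<lambda>b R. indicator A (R *v b) :: real"
  have int: "integrable \<mu> (?h b)" for b
    by (intro hp.integrable_orbit[where C = 1]) (auto simp: indicator_def)
  have int2: "integrable \<mu> (\<lambda>R. ?h b R * ?h c R)" for b c
    by (intro hp.integrable_orbit[where C = 1]) (auto simp: indicator_def)
  have E1: "(\<integral>R. ?h b R \<partial>\<mu>) = u" if "norm b = 1" for b
  proof -
    have "(\<integral>R. ?h b R \<partial>\<mu>) = (\<integral>R. ?h x R \<partial>\<mu>)" by (rule integral_single_law[OF that x]) auto
    also have "\<dots> = (\<integral>R. indicator {R \<in> space \<mu>. R *v x \<in> A} R \<partial>\<mu>)"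
      by (intro Bochner_Integration.integral_cong) (auto simp: indicator_def)
    also have "\<dots> = u" unfolding u_def by simp
    finally show ?thesis .
  qed
  define q where "q = (\<integral>R. ?h hp.e1 R * ?h hp.e2 R \<partial>\<mu>)"
  have E2: "(\<integral>R. ?h b R * ?h c R \<partial>\<mu>) = (if b = c then u else q)" if "b \<in> B" "c \<in> B" for b c
  proof (cases "b = c")
    case True
    have "(\<integral>R. ?h b R * ?h b R \<partial>\<mu>) = (\<integral>R. ?h b R \<partial>\<mu>)"
      by (intro Bochner_Integration.integral_cong) (auto simp: indicator_def)
    then show ?thesis using True E1 onbasis_norm[OF B] that by simp
  next
    case False
    then show ?thesis unfolding q_def
      using integral_pair_law[OF onbasis_onpair[OF B that False] hp.onpair_e, of "indicator A" "indicator A"] by simp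
  qed
  define N where "N = (\<lambda>R. \<Sum>b\<in>B. ?h b R)"
  have EN: "(\<integral>R. N R \<partial>\<mu>) = n * u"
    unfolding N_def using int E1 onbasis_norm[OF B] fin by (simp add: n_def)
  have NN: "(N R)\<^sup>2 = (\<Sum>b\<in>B. \<Sum>c\<in>B. ?h b R * ?h c R)" for R
    by (simp add: N_def power2_eq_square sum_product)
  have intN: "integrable \<mu> N" "integrable \<mu> (\<lambda>R. (N R)\<^sup>2)"
    unfolding NN by (auto simp: N_def intro!: Bochner_Integration.integrable_sum int int2)
  have "(\<integral>R. (N R)\<^sup>2 \<partial>\<mu>) = (\<Sum>b\<in>B. \<Sum>c\<in>B. if b = c then u else q)"
    unfolding NN using int2 E2 by (simp add: Bochner_Integration.integral_sum Bochner_Integration.integrable_sum)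
  also have "\<dots> = (\<Sum>b\<in>B. u + (n - 1) * q)"
  proof (rule sum.cong[OF refl])
    fix b assume b: "b \<in> B"
    have "(\<Sum>c\<in>B. if b = c then u else q) = u + (\<Sum>c\<in>B - {b}. if b = c then u else q)"
      using sum.remove[OF fin(1) b, of "\<lambda>c. if b = c then u else q"] by simp
    also have "(\<Sum>c\<in>B - {b}. if b = c then u else q) = (\<Sum>c\<in>B - {b}. q)"
      by (intro sum.cong) auto
    also have "\<dots> = (n - 1) * q"
      using b fin d by (simp add: card_Diff_singleton n_def of_nat_diff)
    finally show "(\<Sum>c\<in>B. if b = c then u else q) = u + (n - 1) * q" .
  qed
  also have "\<dots> = n * (u + (n - 1) * q)" using fin by (simp add: n_def)
  finally have E3: "(\<integral>R. (N R)\<^sup>2 \<partial>\<mu>) = n * (u + (n - 1) * q)" .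
  have corr: "(n - 1) * (q - u\<^sup>2) \<le> u - u\<^sup>2"
    using hp.orthogonal_correlation_bound[OF A] E1[OF hp.norm_e(1)] by (simp add: n_def q_def)
  have "\<mu>.variance N = n * (u + (n - 1) * q) - (n * u)\<^sup>2"
    using \<mu>.variance_eq[OF intN] EN E3 by simp
  also have "\<dots> = n * ((u - u\<^sup>2) + (n - 1) * (q - u\<^sup>2))"
    by (simp add: power2_eq_square algebra_simps)
  \<comment> \<open>The off-diagonal contribution is at most the diagonal one, which costs only a
    factor 2.\<close>
  also have "\<dots> \<le> n * (2 * (u - u\<^sup>2))" using corr n by (intro mult_left_mono) auto
  also have "\<dots> \<le> n * 1"
  proof (intro mult_left_mono)
    have "0 \<le> (u - 1 / 2)\<^sup>2" by simp
    then show "2 * (u - u\<^sup>2) \<le> 1" by (simp add: power2_eq_square algebra_simps)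
  qed (use n in simp)
  finally have var: "\<mu>.variance N \<le> n" by simp
  have "measure \<mu> {R \<in> space \<mu>. \<delta> < \<bar>real (card ((\<lambda>b. R *v b) ` B \<inter> A)) / real CARD('n) - u\<bar>}
      \<le> measure \<mu> {R \<in> space \<mu>. n * \<delta> \<le> \<bar>N R - (\<integral>R. N R \<partial>\<mu>)\<bar>}"
  proof (rule \<mu>.finite_measure_mono)
    show "{R \<in> space \<mu>. n * \<delta> \<le> \<bar>N R - (\<integral>R. N R \<partial>\<mu>)\<bar>} \<in> sets \<mu>"
      using intN(1) by measurable
    show "{R \<in> space \<mu>. \<delta> < \<bar>real (card ((\<lambda>b. R *v b) ` B \<inter> A)) / real CARD('n) - u\<bar>}
      \<subseteq> {R \<in> space \<mu>. n * \<delta> \<le> \<bar>N R - (\<integral>R. N R \<partial>\<mu>)\<bar>}"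
    proof (intro subsetI CollectI conjI; elim CollectE conjE)
      fix R assume R: "R \<in> space \<mu>" "\<delta> < \<bar>real (card ((\<lambda>b. R *v b) ` B \<inter> A)) / real CARD('n) - u\<bar>"
      have "real (card ((\<lambda>b. R *v b) ` B \<inter> A)) = N R"
        using card_image_Int[OF B, of R A] R by (simp add: N_def space_\<mu>)
      then have "\<delta> \<le> \<bar>N R / n - u\<bar>" using R(2) by (simp add: n_def)
      then have "n * \<delta> \<le> n * \<bar>N R / n - u\<bar>" using n by simp
      also have "\<dots> = \<bar>n * (N R / n - u)\<bar>" using n by (simp add: abs_mult)
      also have "n * (N R / n - u) = N R - n * u" using n by (simp add: right_diff_distrib)
      finally show "n * \<delta> \<le> \<bar>N R - (\<integral>R. N R \<partial>\<mu>)\<bar>" by (simp add: EN)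
    qed
  qed
  also have "\<dots> \<le> \<mu>.variance N / (n * \<delta>)\<^sup>2"
    using n \<delta> intN by (intro \<mu>.Chebyshev_inequality) auto
  also have "\<dots> \<le> n / (n * \<delta>)\<^sup>2" using var by (intro divide_right_mono) auto
  also have "\<dots> = 1 / (n * \<delta>\<^sup>2)" using n by (simp add: power2_eq_square)
  finally show ?thesis by (simp add: n_def)
qed

end

section \<open>Orthonormal bases as random finite sets\<close>

context conj_field
begin

definition onbs :: "('a ^ 'n) set set" where
  "onbs = {B. (\<forall>b\<in>B. \<forall>c\<in>B. ip b c = (if b = c then 1 else 0)) \<and> vec.span B = UNIV}"

lemma ip_sum_right: "ip x (\<Sum>i\<in>I. f i) = (\<Sum>i\<in>I. ip x (f i))"
  by (induction I rule: infinite_finite_induct) (auto simp: ip_def distrib_left sum.distrib)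

text \<open>Pairing a linear relation with one of its vectors shows that orthonormal vectors are
  independent; as they span, their number is the dimension.\<close>

lemma onbs_card:
  fixes B :: "('a ^ 'n) set"
  assumes B: "B \<in> onbs" shows "finite B \<and> card B = CARD('n)"
proof -
  have orth: "ip b c = (if b = c then 1 else 0)" if "b \<in> B" "c \<in> B" for b c
    using B that by (auto simp: onbs_def)
  have "\<not> vec.dependent B"
  proof
    assume "vec.dependent B"
    then obtain t u v where t: "finite t" "t \<subseteq> B" "(\<Sum>v\<in>t. u v *s v) = 0" "v \<in> t" "u v \<noteq> 0"
      unfolding vec.dependent_explicit by blast
    have "0 = ip v (\<Sum>v\<in>t. u v *s v)" by (simp add: t(3) ip_def)
    also have "\<dots> = (\<Sum>w\<in>t. if v = w then u w else 0)"
      unfolding ip_sum_right ip_scale_right using t(2,4) orth by (intro sum.cong) (auto simp: subset_iff)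
    also have "\<dots> = u v" using t(1,4) by simp
    finally show False using t(5) by simp
  qed
  moreover have "vec.span B = UNIV" using B by (simp add: onbs_def)
  ultimately show ?thesis
    using vec.finiteI_independent[of B] vec.dim_span_eq_card_independent[of B] vec_dim_card by metis
qed

lemma onbs_image:
  assumes B: "B \<in> onbs" and R: "R \<in> ugroup"
  shows "(\<lambda>b. R *v b) ` B \<in> onbs"
proof -
  have "\<forall>b\<in>(\<lambda>b. R *v b) ` B. \<forall>c\<in>(\<lambda>b. R *v b) ` B. ip b c = (if b = c then 1 else 0)"
  proof (intro ballI; elim imageE)
    fix b' c' b c assume *: "b' = R *v b" "b \<in> B" "c' = R *v c" "c \<in> B"
    have "b' = c' \<longleftrightarrow> b = c" using * ugroup_adj_cancel(1)[OF R] by metis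
    then show "ip b' c' = (if b' = c' then 1 else 0)"
      using * B by (auto simp: ugroup_ip[OF R] onbs_def)
  qed
  moreover have "vec.span ((\<lambda>b. R *v b) ` B) = (\<lambda>b. R *v b) ` vec.span B"
    by (rule vec.span_image)
  moreover have "(\<lambda>b. R *v b) ` UNIV = UNIV"
    using ugroup_adj_cancel(2)[OF R] by (metis surjI)
  ultimately show ?thesis using B by (simp add: onbs_def)
qed

end

lemma onb_space_generator_subset:
  "{{B \<in> \<B>. card (B \<inter> A) = k} | A k. A \<in> sets borel \<and> A \<subseteq> sphere 0 1} \<subseteq> Pow \<B>"
  by auto

lemma space_onb_space: "space (onb_space \<B>) = \<B>"
  unfolding onb_space_def by (rule space_measure_of[OF onb_space_generator_subset])

lemma measurable_card_Int:
  assumes "A \<in> sets borel" "A \<subseteq> sphere 0 1"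
  shows "(\<lambda>B. card (B \<inter> A)) \<in> onb_space \<B> \<rightarrow>\<^sub>M count_space UNIV"
proof (rule measurable_count_space_eq_countable[THEN iffD2])
  show "(\<lambda>B. card (B \<inter> A)) \<in> space (onb_space \<B>) \<rightarrow> UNIV \<and>
    (\<forall>k\<in>UNIV. (\<lambda>B. card (B \<inter> A)) -` {k} \<inter> space (onb_space \<B>) \<in> sets (onb_space \<B>))"
  proof (intro conjI ballI)
    fix k
    have "{B \<in> \<B>. card (B \<inter> A) = k} \<in> sets (onb_space \<B>)"
      unfolding onb_space_def sets_measure_of[OF onb_space_generator_subset]
      using assms by (intro sigma_sets.Basic) blast
    moreover have "(\<lambda>B. card (B \<inter> A)) -` {k} \<inter> space (onb_space \<B>) = {B \<in> \<B>. card (B \<inter> A) = k}"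
      by (auto simp: space_onb_space)
    ultimately show "(\<lambda>B. card (B \<inter> A)) -` {k} \<inter> space (onb_space \<B>) \<in> sets (onb_space \<B>)" by simp
  qed simp
qed simp

context haar_action
begin

lemma onbs_onbasis: "B \<in> onbs \<Longrightarrow> onbasis B"
  using onbs_card[of B] by (simp add: onbasis_def onbs_def)

text \<open>It suffices to treat the generating sets, on which the count of image vectors is a
  finite sum of indicators.\<close>

lemma measurable_basis_image:
  assumes B0: "B0 \<in> onbs"
  shows "(\<lambda>R. (\<lambda>b. R *v b) ` B0) \<in> \<mu> \<rightarrow>\<^sub>M onb_space onbs"
  unfolding onb_space_def
proof (rule measurable_measure_of[OF onb_space_generator_subset])
  show "(\<lambda>R. (\<lambda>b. R *v b) ` B0) \<in> space \<mu> \<rightarrow> onbs" using onbs_image[OF B0] by (simp add: space_\<mu>)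
  fix y assume "y \<in> {{B \<in> onbs. card (B \<inter> A) = k} | A k. A \<in> sets borel \<and> A \<subseteq> sphere (0 :: 'a ^ 'n) 1}"
  then obtain A k where y: "y = {B \<in> onbs. card (B \<inter> A) = k}" and [measurable]: "A \<in> sets borel" by blast
  have "(\<lambda>R. (\<lambda>b. R *v b) ` B0) -` y \<inter> space \<mu> = {R \<in> space \<mu>. (\<Sum>b\<in>B0. indicator A (R *v b)) = real k}"
    using onbs_image[OF B0] card_image_Int[OF onbs_onbasis[OF B0], of _ A, symmetric]
    by (auto simp: y space_\<mu>)
  also have "\<dots> \<in> sets \<mu>" by measurable
  finally show "(\<lambda>R. (\<lambda>b. R *v b) ` B0) -` y \<inter> space \<mu> \<in> sets \<mu>" .
qed

text \<open>The event depends only on the law of \<open>B\<close>, so it can be computed under Haar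
  measure. A union bound over the \<open>m\<close> cells, each failing with probability at most
  \<open>1 / (n * \<delta>\<^sup>2)\<close>, gives \<open>\<epsilon>\<close>.\<close>

lemma random_basis_concentration:
  fixes B :: "'w \<Rightarrow> ('a ^ 'n) set" and M :: "'w measure"
  assumes M: "prob_space M" and B[measurable]: "B \<in> M \<rightarrow>\<^sub>M onb_space onbs" and B0: "B0 \<in> onbs"
    and law: "distr M (onb_space onbs) B = distr \<mu> (onb_space onbs) (\<lambda>R. (\<lambda>b. R *v b) ` B0)"
    and part: "borel_partition m A (sphere 0 1)"
    and pos: "\<epsilon> > 0" "\<delta> > 0" and d: "CARD('n) \<ge> 2"
    and large: "real CARD('n) \<ge> real m * inverse (\<delta>\<^sup>2) * inverse \<epsilon>"
  shows "1 - \<epsilon> \<le> measure M {\<omega> \<in> space M. \<forall>k\<in>{1..m}.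
    \<bar>real (card (B \<omega> \<inter> A k)) / real CARD('n) - measure sphere_uniform (A k)\<bar> \<le> \<delta>}"
proof -
  interpret \<mu>: prob_space \<mu> by (rule prob_space_\<mu>)
  have A: "A k \<in> sets borel" "A k \<subseteq> sphere 0 1" if "k \<in> {1..m}" for k
    using part that unfolding borel_partition_def by auto
  define n where "n = real CARD('n)"
  have n: "n > 0" using d by (simp add: n_def)
  define dev where "dev k C = \<bar>real (card (C \<inter> A k)) / n - measure sphere_uniform (A k)\<bar>" for k C
  \<comment> \<open>The event is described as a measurable set of bases, so that the equality of
    laws applies to it.\<close>
  define E where "E = {C \<in> space (onb_space onbs). \<forall>k\<in>{1..m}. dev k C \<le> \<delta>}"
  have dev_meas: "dev k \<in> borel_measurable (onb_space onbs)" if "k \<in> {1..m}" for k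
    using measurable_card_Int[OF A[OF that]] unfolding dev_def by measurable
  have E[measurable]: "E \<in> sets (onb_space onbs)"
    unfolding E_def using dev_meas by (intro sets.sets_Collect_finite_All) (auto intro: borel_measurable_le)
  note [measurable] = measurable_basis_image[OF B0]
  let ?im = "\<lambda>R. (\<lambda>b. R *v b) ` B0"
  have "B -` E \<inter> space M = {\<omega> \<in> space M. \<forall>k\<in>{1..m}. dev k (B \<omega>) \<le> \<delta>}"
    using measurable_space[OF B] by (auto simp: E_def)
  then have "measure M {\<omega> \<in> space M. \<forall>k\<in>{1..m}. dev k (B \<omega>) \<le> \<delta>} = measure (distr M (onb_space onbs) B) E"
    by (simp add: measure_distr)
  also have "\<dots> = measure \<mu> (?im -` E \<inter> space \<mu>)" unfolding law by (rule measure_distr) measurable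
  also have "\<dots> = 1 - measure \<mu> (space \<mu> - (?im -` E \<inter> space \<mu>))"
    using \<mu>.prob_compl[of "?im -` E \<inter> space \<mu>"] by (simp add: measurable_sets[OF measurable_basis_image[OF B0] E])
  finally have compl: "measure M {\<omega> \<in> space M. \<forall>k\<in>{1..m}. dev k (B \<omega>) \<le> \<delta>} =
      1 - measure \<mu> (space \<mu> - (?im -` E \<inter> space \<mu>))" .
  have "measure \<mu> (space \<mu> - (?im -` E \<inter> space \<mu>)) \<le>
      measure \<mu> (\<Union>k\<in>{1..m}. {R \<in> space \<mu>. \<delta> < dev k (?im R)})"
  proof (rule \<mu>.finite_measure_mono)
    show "space \<mu> - (?im -` E \<inter> space \<mu>) \<subseteq> (\<Union>k\<in>{1..m}. {R \<in> space \<mu>. \<delta> < dev k (?im R)})"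
      using measurable_space[OF measurable_basis_image[OF B0]] by (auto simp: E_def not_le)
    show "(\<Union>k\<in>{1..m}. {R \<in> space \<mu>. \<delta> < dev k (?im R)}) \<in> sets \<mu>"
      using measurable_compose[OF measurable_basis_image[OF B0] dev_meas]
      by (intro sets.finite_UN) (auto intro: borel_measurable_less)
  qed
  also have "\<dots> \<le> (\<Sum>k\<in>{1..m}. measure \<mu> {R \<in> space \<mu>. \<delta> < dev k (?im R)})"
    using measurable_compose[OF measurable_basis_image[OF B0] dev_meas]
    by (intro \<mu>.finite_measure_subadditive_finite) (auto intro: borel_measurable_less)
  also have "\<dots> \<le> (\<Sum>k\<in>{1..m}. 1 / (n * \<delta>\<^sup>2))"
  proof (rule sum_mono)
    fix k assume k: "k \<in> {1..m}"
    obtain x :: "'a ^ 'n" where x: "norm x = 1" using norm_axis_one by blast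
    show "measure \<mu> {R \<in> space \<mu>. \<delta> < dev k (?im R)} \<le> 1 / (n * \<delta>\<^sup>2)"
      using basis_count_tail[OF onbs_onbasis[OF B0] A(1)[OF k] d pos(2) x]
      unfolding dev_def n_def sphere_uniform_eq_orbit_law[OF x A[OF k]] .
  qed
  also have "\<dots> \<le> \<epsilon>"
  proof -
    have "real m * inverse (\<delta>\<^sup>2) * inverse \<epsilon> \<le> n" using large by (simp add: n_def)
    then show ?thesis using n pos by (simp add: field_simps)
  qed
  finally have "1 - \<epsilon> \<le> measure M {\<omega> \<in> space M. \<forall>k\<in>{1..m}. dev k (B \<omega>) \<le> \<delta>}"
    unfolding compl by simp
  then show ?thesis unfolding dev_def n_def .
qed

end

section \<open>The real and the complex instance\<close>

lemma conj_field_real: "conj_field (\<lambda>x::real. x)"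
  by unfold_locales (auto simp: algebra_simps)

lemma conj_field_complex: "conj_field cnj"
  by unfold_locales (auto simp: complex_eq_iff inner_complex_def algebra_simps)

lemma orthogonal_group_eq: "orthogonal_group = conj_field.ugroup (\<lambda>x::real. x)"
  unfolding orthogonal_group_def conj_field.ugroup_def[OF conj_field_real] conj_field.adj_def[OF conj_field_real]
    orthogonal_matrix_def transpose_def ..

text \<open>Besides the inner products, the two notions of span have to be matched; over the reals
  they coincide.\<close>

lemma real_onbs_eq: "real_onbs = conj_field.onbs (\<lambda>x::real. x)"
  unfolding real_onbs_def conj_field.onbs_def[OF conj_field_real] conj_field.ip_def[OF conj_field_real]
  by (simp add: inner_vec_def span_vec_eq)

lemma unitary_group_eq: "unitary_group = conj_field.ugroup cnj"
  unfolding unitary_group_def conj_field.ugroup_def[OF conj_field_complex] conj_field.adj_def[OF conj_field_complex]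
    cadjoint_def ..

lemma complex_onbs_eq: "complex_onbs = conj_field.onbs cnj"
  unfolding complex_onbs_def conj_field.onbs_def[OF conj_field_complex] conj_field.ip_def[OF conj_field_complex]
    cinner_def ..

theorem corollary1:
  fixes \<epsilon> \<delta> :: real and m :: nat
  assumes "\<epsilon> > 0" and "\<delta> > 0" and "m \<ge> 1"
    and "CARD('n::finite) \<ge> 4"
    and "real CARD('n) \<ge> real m * inverse (\<delta>\<^sup>2) * inverse \<epsilon>"
  shows
    "(\<forall>(M :: 'w measure) (B :: 'w \<Rightarrow> (real ^ 'n) set).
        prob_space M \<and> B \<in> M \<rightarrow>\<^sub>M onb_space real_onbs \<and>
        uniform_onb orthogonal_group real_onbs (distr M (onb_space real_onbs) B) \<longrightarrow>
        (\<forall>A. borel_partition m A (sphere 0 1) \<longrightarrow>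
           measure M {\<omega> \<in> space M. \<forall>k\<in>{1..m}.
             \<bar>real (card (B \<omega> \<inter> A k)) / real CARD('n) - measure sphere_uniform (A k)\<bar> \<le> \<delta>}
           \<ge> 1 - \<epsilon>)) \<and>
     (\<forall>(M :: 'w measure) (B :: 'w \<Rightarrow> (complex ^ 'n) set).
        prob_space M \<and> B \<in> M \<rightarrow>\<^sub>M onb_space complex_onbs \<and>
        uniform_onb unitary_group complex_onbs (distr M (onb_space complex_onbs) B) \<longrightarrow>
        (\<forall>A. borel_partition m A (sphere 0 1) \<longrightarrow>
           measure M {\<omega> \<in> space M. \<forall>k\<in>{1..m}.
             \<bar>real (card (B \<omega> \<inter> A k)) / real CARD('n) - measure sphere_uniform (A k)\<bar> \<le> \<delta>}
           \<ge> 1 - \<epsilon>))"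
proof (intro conjI allI impI; elim conjE)
  fix M :: "'w measure" and B :: "'w \<Rightarrow> (real ^ 'n) set" and A
  assume M: "prob_space M" "B \<in> M \<rightarrow>\<^sub>M onb_space real_onbs"
    and law: "uniform_onb orthogonal_group real_onbs (distr M (onb_space real_onbs) B)"
    and part: "borel_partition m A (sphere (0 :: real ^ 'n) 1)"
  \<comment> \<open>Any Haar measure and starting basis that witness the law will do, since the
    concentration lemma holds for all of them.\<close>
  from law obtain \<mu> B0 where *: "normalized_haar orthogonal_group \<mu>" "B0 \<in> real_onbs"
      "distr M (onb_space real_onbs) B = distr \<mu> (onb_space real_onbs) (\<lambda>R. (\<lambda>b. R *v b) ` B0)"
    unfolding uniform_onb_def by blast
  have "haar_action (\<lambda>x. x) \<mu>"
    using conj_field_real *(1) by (simp add: haar_action_def haar_action_axioms_def orthogonal_group_eq)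
  from haar_action.random_basis_concentration[OF this M[unfolded real_onbs_eq] *(2,3)[unfolded real_onbs_eq] part]
  show "measure M {\<omega> \<in> space M. \<forall>k\<in>{1..m}.
      \<bar>real (card (B \<omega> \<inter> A k)) / real CARD('n) - measure sphere_uniform (A k)\<bar> \<le> \<delta>} \<ge> 1 - \<epsilon>"
    using assms by simp
next
  fix M :: "'w measure" and B :: "'w \<Rightarrow> (complex ^ 'n) set" and A
  assume M: "prob_space M" "B \<in> M \<rightarrow>\<^sub>M onb_space complex_onbs"
    and law: "uniform_onb unitary_group complex_onbs (distr M (onb_space complex_onbs) B)"
    and part: "borel_partition m A (sphere (0 :: complex ^ 'n) 1)"
  from law obtain \<mu> B0 where *: "normalized_haar unitary_group \<mu>" "B0 \<in> complex_onbs"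
      "distr M (onb_space complex_onbs) B = distr \<mu> (onb_space complex_onbs) (\<lambda>R. (\<lambda>b. R *v b) ` B0)"
    unfolding uniform_onb_def by blast
  have "haar_action cnj \<mu>"
    using conj_field_complex *(1) by (simp add: haar_action_def haar_action_axioms_def unitary_group_eq)
  from haar_action.random_basis_concentration[OF this M[unfolded complex_onbs_eq] *(2,3)[unfolded complex_onbs_eq] part]
  show "measure M {\<omega> \<in> space M. \<forall>k\<in>{1..m}.
      \<bar>real (card (B \<omega> \<inter> A k)) / real CARD('n) - measure sphere_uniform (A k)\<bar> \<le> \<delta>} \<ge> 1 - \<epsilon>"
    using assms by simp
qed

end
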